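(* There is an absolute constant $A>0$ such that for every (nonzero, real-valued) eigenfunction $\varphi$ of the Laplacian on $\mathbb{T}^2$ with eigenvalue $E\ge 1$ (in the normalization of the context), the total curvature $K_\varphi$ of its nodal set satisfies $$K_\varphi\le A\,E.$$
   Context: $\mathbb{T}^2=\mathbb{R}^2/\mathbb{Z}^2$ is the standard flat torus and $e(t)=\exp(2\pi i t)$. An eigenfunction with eigenvalue $E$ (the Laplace eigenvalue is actually $4\pi^2E$; $E$ is an integer which is a sum of two squares) is a nonzero real-valued function $\varphi(x)=\sum_{\xi\in\mathbb{Z}^2,\ |\xi|^2=E}a_\xi\, e(x\cdot\xi)$ with $\overline{a_\xi}=a_{-\xi}$. Its nodal set is $\mathcal{N}_\varphi=\{x\in\mathbb{T}^2:\varphi(x)=0\}$; it is a union of $C^2$-immersed circles, with at most finitely many singular points (the nodal lines through a singular point form an equiangular system). The total curvature of a $C^2$ curve $C$ with arc-length parametrization $\gamma:[0,\ell]\to C$ is $K(C)=\int_0^\ell\|\ddot\gamma(s)\|\,ds$. The total curvature $K_\varphi$ of the nodal set is the total curvature of the $C^2$-immersed curves constituting $\mathcal{N}_\varphi$, i.e. the integral of the absolute value of the curvature with respect to arc length over $\mathcal{N}_\varphi$ (minus its finitely many singular points). *)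

theory Defs
  imports "HOL-Analysis.Analysis"
begin

text \<open>
  Functions on the torus are functions on the plane given by exponentials with integer
  frequencies; subsets of the torus are given by their periodic preimages in the plane, and curves
  on the torus by their lifts to the plane. Two points of the plane represent the same point of
  the torus iff they are related by \<open>torus_eq\<close>.
\<close>

definition torus_eq :: "real ^ 2 \<Rightarrow> real ^ 2 \<Rightarrow> bool" where
  "torus_eq x y \<longleftrightarrow> (\<forall>i. x $ i - y $ i \<in> \<int>)"

definition e :: "real \<Rightarrow> complex" where
  "e t = exp (2 * complex_of_real pi * \<i> * complex_of_real t)"

definition freqs :: "nat \<Rightarrow> (int ^ 2) set" where
  "freqs E = {\<xi>. (\<Sum>i\<in>UNIV. (\<xi> $ i)\<^sup>2) = int E}"

definition eigenfunction :: "nat \<Rightarrow> (real ^ 2 \<Rightarrow> real) \<Rightarrow> bool" where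
  "eigenfunction E \<phi> \<longleftrightarrow>
     (\<exists>x. \<phi> x \<noteq> 0) \<and>
     (\<exists>a :: int ^ 2 \<Rightarrow> complex.
        (\<forall>\<xi>\<in>freqs E. cnj (a \<xi>) = a (- \<xi>)) \<and>
        (\<forall>x. complex_of_real (\<phi> x) =
               (\<Sum>\<xi>\<in>freqs E. a \<xi> * e (x \<bullet> (\<chi> i. real_of_int (\<xi> $ i))))))"

definition nodal_set :: "(real ^ 2 \<Rightarrow> real) \<Rightarrow> (real ^ 2) set" where
  "nodal_set \<phi> = {x. \<phi> x = 0}"

definition singular_set :: "(real ^ 2 \<Rightarrow> real) \<Rightarrow> (real ^ 2) set" where
  "singular_set \<phi> = {x \<in> nodal_set \<phi>. (\<phi> has_derivative (\<lambda>_. 0)) (at x)}"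

definition arclength_C2 :: "real \<Rightarrow> (real \<Rightarrow> real ^ 2) \<Rightarrow> bool" where
  "arclength_C2 l \<gamma> \<longleftrightarrow> 0 < l \<and>
     (\<exists>\<gamma>1 \<gamma>2. (\<forall>s\<in>{0..l}. (\<gamma> has_vector_derivative \<gamma>1 s) (at s within {0..l})) \<and>
              (\<forall>s\<in>{0..l}. (\<gamma>1 has_vector_derivative \<gamma>2 s) (at s within {0..l})) \<and>
              continuous_on {0..l} \<gamma>2 \<and>
              (\<forall>s\<in>{0..l}. norm (\<gamma>1 s) = 1))"

definition second_derivative :: "real \<Rightarrow> (real \<Rightarrow> real ^ 2) \<Rightarrow> real \<Rightarrow> real ^ 2" where
  "second_derivative l \<gamma> s =
     vector_derivative (\<lambda>t. vector_derivative \<gamma> (at t within {0..l})) (at s within {0..l})"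

definition curve_total_curvature :: "real \<Rightarrow> (real \<Rightarrow> real ^ 2) \<Rightarrow> real" where
  "curve_total_curvature l \<gamma> = integral {0..l} (\<lambda>s. norm (second_derivative l \<gamma> s))"

text \<open>
  A finite family of \<open>C\<^sup>2\<close> curves in the nodal set, parametrized by arc length, which pass through
  singular points only finitely often and meet every regular point of the nodal set (on the torus)
  at most once. The parameter \<open>l i\<close> is left out of the last condition, so that closed curves are
  admitted; self-intersections and mutual intersections are possible at singular points only.
\<close>

definition nodal_curves ::
  "(real ^ 2 \<Rightarrow> real) \<Rightarrow> nat \<Rightarrow> (nat \<Rightarrow> real) \<Rightarrow> (nat \<Rightarrow> real \<Rightarrow> real ^ 2) \<Rightarrow> bool" where
  "nodal_curves \<phi> n l \<gamma> \<longleftrightarrow>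
     (\<forall>i<n. arclength_C2 (l i) (\<gamma> i) \<and> \<gamma> i ` {0..l i} \<subseteq> nodal_set \<phi> \<and>
            finite {s \<in> {0..l i}. \<gamma> i s \<in> singular_set \<phi>}) \<and>
     (\<forall>i<n. \<forall>j<n. \<forall>s\<in>{0..<l i}. \<forall>t\<in>{0..<l j}.
        torus_eq (\<gamma> i s) (\<gamma> j t) \<and> \<gamma> i s \<notin> singular_set \<phi> \<longrightarrow> i = j \<and> s = t)"

text \<open>
  The integral of the absolute curvature with respect to arc length over the regular part of the
  nodal set. At a regular point the curvature of a curve in the nodal set is that of the nodal set
  itself, so a family as above contributes the integral over the part of the nodal set which it
  covers; the supremum is attained by every family of closed curves constituting the whole
  nodal set. Writing it as a supremum makes it well defined (possibly infinite) without
  presupposing that such a family exists.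
\<close>

definition nodal_total_curvature :: "(real ^ 2 \<Rightarrow> real) \<Rightarrow> ennreal" where
  "nodal_total_curvature \<phi> =
     (SUP (n, l, \<gamma>)\<in>{(n, l, \<gamma>). nodal_curves \<phi> n l \<gamma>}.
        ennreal (\<Sum>i<n. curve_total_curvature (l i) (\<gamma> i)))"

end

theory Submission
  imports Defs "HOL-Computational_Algebra.Polynomial_Factorial"
    "HOL-Computational_Algebra.Field_as_Ring"
begin

text \<open>
  The curvature of a plane curve is the speed at which its unit tangent turns, so a bound on the
  total curvature follows from a bound on how often a given direction \<open>v\<close> occurs as the tangent
  of the nodal set. Where it occurs, both \<open>\<phi>\<close> and its derivative \<open>\<partial>\<^sub>v \<phi>\<close> vanish. Differentiating
  \<open>\<phi> (\<gamma> s) = 0\<close> twice shows that this common zero is nondegenerate if the curvature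
  is not \<open>0\<close> there (\<open>nodal_curve_nondegenerate\<close>). In the variables \<open>z = e x\<^sub>1\<close>, \<open>w = e x\<^sub>2\<close> both functions
  are, up to a monomial factor, polynomials of degree at most \<open>2 M\<close> in each variable, where
  \<open>M\<close> is the integer part of the square root of \<open>E\<close>. By Bezout's theorem they have at most
  \<open>2 (2 M)\<^sup>2 = 8 M\<^sup>2\<close> nondegenerate common zeros (\<open>nondegenerate_trig_zeros\<close>).

  To pass from this count to the integral, consider one coordinate of the unit tangent.
  The integral of \<open>\<bar>\<gamma>''\<^sub>k\<bar>\<close> is the total variation of \<open>\<gamma>'\<^sub>k\<close>, a function with values in
  \<open>[-1, 1]\<close>, hence at most \<open>2\<close> times the largest number of times that a value is taken with nonzero
  derivative (Banach's indicatrix, \<open>total_variation_le_multiplicity\<close>). A value of one coordinate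
  leaves two directions for a unit vector, so a value is taken at most \<open>16 M\<^sup>2\<close> times, and the two
  coordinates together contribute at most \<open>2 * 2 * 16 M\<^sup>2\<close>. This is at most \<open>64 E\<close>.

  Bezout's theorem is proved by comparing dimensions, in the form in which the curves may have
  common components: the greatest common divisor of the two polynomials does not vanish at a
  nondegenerate common zero (\<open>gcd_nonzero_at_nondegenerate_zero\<close>), so it can be divided out,
  and coprime polynomials are treated in \<open>bezout_coprime\<close>.
\<close>

section \<open>Bivariate polynomials\<close>

lemma underdetermined_system:
  fixes M :: "'j \<Rightarrow> 'i \<Rightarrow> 'a::field"
  assumes "finite J" "finite I" "card J < card I"
  shows "\<exists>x. (\<exists>i\<in>I. x i \<noteq> 0) \<and> (\<forall>j\<in>J. (\<Sum>i\<in>I. M j i * x i) = 0)"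
  using assms
proof (induction J arbitrary: I M rule: finite_induct)
  case empty
  then have "I \<noteq> {}" by auto
  then show ?case by (intro exI[of _ "\<lambda>_. 1"]) auto
next
  case (insert j0 J)
  show ?case
  proof (cases "\<forall>i\<in>I. M j0 i = 0")
    case True
    have "card J < card I" using insert by simp
    then obtain x where "\<exists>i\<in>I. x i \<noteq> 0" "\<forall>j\<in>J. (\<Sum>i\<in>I. M j i * x i) = 0"
      using insert.IH[of I M] insert.prems by blast
    then show ?thesis using True by (intro exI[of _ x]) auto
  next
    case False
    then obtain i0 where i0: "i0 \<in> I" "M j0 i0 \<noteq> 0" by auto
    define M' where "M' j i = M j i - M j i0 * M j0 i / M j0 i0" for j i
    have "card J < card (I - {i0})" using insert i0 by simp
    then obtain x where x: "\<exists>i\<in>I - {i0}. x i \<noteq> 0"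
        "\<forall>j\<in>J. (\<Sum>i\<in>I - {i0}. M' j i * x i) = 0"
      using insert.IH[of "I - {i0}" M'] insert.prems by blast
    \<comment> \<open>Eliminate the unknown \<open>i0\<close> with the help of equation \<open>j0\<close>, then solve for it.\<close>
    define S where "S = (\<Sum>i\<in>I - {i0}. M j0 i * x i)"
    define y where "y = x(i0 := - S / M j0 i0)"
    have split: "(\<Sum>i\<in>I. M j i * y i) = - M j i0 * S / M j0 i0 + (\<Sum>i\<in>I - {i0}. M j i * x i)" for j
    proof -
      have "(\<Sum>i\<in>I. M j i * y i) = M j i0 * y i0 + (\<Sum>i\<in>I - {i0}. M j i * y i)"
        using i0 insert.prems by (simp add: sum.remove)
      moreover have "(\<Sum>i\<in>I - {i0}. M j i * y i) = (\<Sum>i\<in>I - {i0}. M j i * x i)"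
        by (rule sum.cong) (auto simp: y_def)
      ultimately show ?thesis by (simp add: y_def)
    qed
    have "(\<Sum>i\<in>I. M j i * y i) = 0" if "j \<in> insert j0 J" for j
    proof (cases "j = j0")
      case True
      then show ?thesis unfolding split using i0 by (simp add: S_def)
    next
      case False
      then have "0 = (\<Sum>i\<in>I - {i0}. M' j i * x i)" using that x by simp
      also have "\<dots> = (\<Sum>i\<in>I - {i0}. M j i * x i - (M j i0 / M j0 i0) * (M j0 i * x i))"
        by (rule sum.cong) (auto simp: M'_def field_simps)
      also have "\<dots> = (\<Sum>i\<in>I - {i0}. M j i * x i) - (M j i0 / M j0 i0) * S"
        by (simp add: sum_subtractf S_def sum_distrib_left)
      finally show ?thesis unfolding split by simp
    qed
    moreover have "\<exists>i\<in>I. y i \<noteq> 0" using x by (auto simp: y_def)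
    ultimately show ?thesis by blast
  qed
qed

text \<open>
  A polynomial in \<open>z\<close> and \<open>w\<close> is a polynomial in \<open>w\<close> whose coefficients are polynomials in \<open>z\<close>. Its
  degree in \<open>w\<close> is \<open>degree\<close>; the degree in \<open>z\<close> is only ever bounded from above.
\<close>

definition inner_degree_le :: "nat \<Rightarrow> 'a::zero poly poly \<Rightarrow> bool" where
  "inner_degree_le d P \<longleftrightarrow> (\<forall>i. degree (coeff P i) \<le> d)"

definition eval2 :: "'a::comm_ring_1 poly poly \<Rightarrow> 'a \<Rightarrow> 'a \<Rightarrow> 'a" where
  "eval2 P z w = poly (poly P [:w:]) z"

lemma eval2_simps [simp]:
  "eval2 0 z w = 0"
  "eval2 (P + Q) z w = eval2 P z w + eval2 Q z w"
  "eval2 (P * Q) z w = eval2 P z w * eval2 Q z w"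
  "eval2 (monom (monom a i) j) z w = a * z ^ i * w ^ j"
  "eval2 [:p:] z w = poly p z"
  "eval2 (smult p Q) z w = poly p z * eval2 Q z w"
  by (simp_all add: eval2_def poly_monom poly_power)

lemma eval2_sum: "eval2 (sum f S) z w = (\<Sum>i\<in>S. eval2 (f i) z w)"
  by (simp add: eval2_def poly_sum)

lemma eval2_prod: "eval2 (prod f S) z w = (\<Prod>i\<in>S. eval2 (f i) z w)"
  by (simp add: eval2_def poly_prod)

lemma inner_degree_le_mono: "inner_degree_le m P \<Longrightarrow> m \<le> n \<Longrightarrow> inner_degree_le n P"
  unfolding inner_degree_le_def using le_trans by blast

lemma inner_degree_le_exists: "\<exists>d. inner_degree_le d P"
proof (intro exI)
  show "inner_degree_le (Max ((\<lambda>i. degree (coeff P i)) ` {..degree P})) P"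
    unfolding inner_degree_le_def
  proof
    fix i
    show "degree (coeff P i) \<le> Max ((\<lambda>i. degree (coeff P i)) ` {..degree P})"
      by (cases "i \<le> degree P") (auto simp: coeff_eq_0)
  qed
qed

lemma coeff_mult_at_bounds:
  fixes p q :: "'a::comm_semiring_0 poly"
  assumes "degree p \<le> k" "degree q \<le> l"
  shows "coeff (p * q) (k + l) = coeff p k * coeff q l"
proof -
  have "coeff (p * q) (k + l) = (\<Sum>i\<le>k + l. coeff p i * coeff q (k + l - i))"
    by (rule coeff_mult)
  also have "\<dots> = (\<Sum>i\<in>{k}. coeff p i * coeff q (k + l - i))"
  proof (rule sum.mono_neutral_right)
    show "\<forall>i\<in>{..k + l} - {k}. coeff p i * coeff q (k + l - i) = 0"
    proof
      fix i assume i: "i \<in> {..k + l} - {k}"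
      show "coeff p i * coeff q (k + l - i) = 0"
      proof (cases "i < k")
        case True
        then have "degree q < k + l - i" using assms by linarith
        then show ?thesis by (simp add: coeff_eq_0)
      next
        case False
        then have "degree p < i" using assms i by auto
        then show ?thesis by (simp add: coeff_eq_0)
      qed
    qed
  qed auto
  finally show ?thesis by simp
qed

lemma inner_degree_le_mult:
  fixes P Q :: "'a::comm_semiring_0 poly poly"
  assumes "inner_degree_le k P" "inner_degree_le l Q"
  shows "inner_degree_le (k + l) (P * Q)"
  unfolding inner_degree_le_def
proof
  fix n
  have "degree (coeff P i * coeff Q (n - i)) \<le> k + l" for i
    using degree_mult_le[of "coeff P i" "coeff Q (n - i)"] assms
    unfolding inner_degree_le_def by (meson add_mono le_trans)
  then show "degree (coeff (P * Q) n) \<le> k + l"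
    unfolding coeff_mult by (intro degree_sum_le) auto
qed

text \<open>
  Degrees in \<open>z\<close> add up in products, because over an integral domain the coefficients of the highest
  powers of \<open>z\<close>, which are polynomials in \<open>w\<close>, multiply to something nonzero.
\<close>

lemma inner_degree_le_factor:
  fixes P Q :: "'a::idom poly poly"
  assumes "inner_degree_le d (P * Q)" "P \<noteq> 0"
  shows "inner_degree_le d Q"
proof (rule ccontr)
  define top where "top k R = map_poly (\<lambda>q. coeff q k) R" for k and R :: "'a poly poly"
  have coeff_top: "coeff (top k R) n = coeff (coeff R n) k" for k n R
    by (simp add: top_def coeff_map_poly)
  have top_mult: "top (k + l) (R * S) = top k R * top l S"
    if "inner_degree_le k R" "inner_degree_le l S" for k l R S
  proof (rule poly_eqI)
    fix n
    have "coeff (coeff R i * coeff S (n - i)) (k + l) = coeff (coeff R i) k * coeff (coeff S (n - i)) l" for i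
      using that by (intro coeff_mult_at_bounds) (auto simp: inner_degree_le_def)
    then show "coeff (top (k + l) (R * S)) n = coeff (top k R * top l S) n"
      by (simp add: coeff_top coeff_mult coeff_sum)
  qed
  have top_exists: "\<exists>k. inner_degree_le k R \<and> top k R \<noteq> 0" if "R \<noteq> 0" for R
  proof -
    define k where "k = (LEAST k. inner_degree_le k R)"
    have k: "inner_degree_le k R" unfolding k_def using inner_degree_le_exists LeastI_ex by metis
    have "top k R \<noteq> 0"
    proof
      assume "top k R = 0"
      then have c: "coeff (coeff R n) k = 0" for n using coeff_top by (metis coeff_0)
      show False
      proof (cases k)
        case 0
        then have "coeff R n = 0" for n
          using c[of n] k unfolding inner_degree_le_def
          by (metis le_zero_eq leading_coeff_0_iff)
        then show False using that by (simp add: poly_eq_iff)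
      next
        case (Suc j)
        have "degree (coeff R n) \<le> j" for n
        proof (rule degree_le, intro allI impI)
          fix i assume "j < i"
          then show "coeff (coeff R n) i = 0"
            using c[of n] k Suc unfolding inner_degree_le_def
            by (metis Suc_lessI coeff_eq_0 le_imp_less_Suc le_less_trans less_Suc_eq not_less_eq)
        qed
        then have "inner_degree_le j R" by (simp add: inner_degree_le_def)
        then have "k \<le> j" unfolding k_def by (rule Least_le)
        then show False using Suc by simp
      qed
    qed
    with k show ?thesis by blast
  qed
  assume not: "\<not> inner_degree_le d Q"
  then have "Q \<noteq> 0" by (auto simp: inner_degree_le_def)
  then obtain k l where kl: "inner_degree_le k P" "top k P \<noteq> 0" "inner_degree_le l Q" "top l Q \<noteq> 0"
    using top_exists assms by metis
  have "l > d" using kl not inner_degree_le_mono by (metis not_le)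
  have "top (k + l) (P * Q) \<noteq> 0" using top_mult kl by simp
  then obtain n where "coeff (coeff (P * Q) n) (k + l) \<noteq> 0"
    by (metis coeff_top leading_coeff_0_iff)
  then have "k + l \<le> degree (coeff (P * Q) n)" by (rule le_degree)
  moreover have "degree (coeff (P * Q) n) \<le> d" using assms(1) by (simp add: inner_degree_le_def)
  ultimately show False using \<open>l > d\<close> by linarith
qed

text \<open>
  The space of polynomials of degree less than \<open>n\<close> in \<open>w\<close> and less than \<open>m\<close> in \<open>z\<close> has dimension \<open>n m\<close>.
  The polynomials are given as a family, not as a set, so that a repetition counts as a dependence.
\<close>

lemma bivariate_dependence:
  fixes f :: "'i \<Rightarrow> 'a::field poly poly"
  assumes "finite I" "n * m < card I"
    and deg: "\<And>i j. i \<in> I \<Longrightarrow> n \<le> j \<Longrightarrow> coeff (f i) j = 0"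
    and ideg: "\<And>i j k. i \<in> I \<Longrightarrow> m \<le> k \<Longrightarrow> coeff (coeff (f i) j) k = 0"
  shows "\<exists>x. (\<exists>i\<in>I. x i \<noteq> 0) \<and> (\<Sum>i\<in>I. smult [:x i:] (f i)) = 0"
proof -
  have "card ({..<n} \<times> {..<m}) < card I" using assms by simp
  then obtain x where x: "\<exists>i\<in>I. x i \<noteq> 0"
    and eq: "\<forall>(j, k)\<in>{..<n} \<times> {..<m}. (\<Sum>i\<in>I. coeff (coeff (f i) j) k * x i) = 0"
    using underdetermined_system[of "{..<n} \<times> {..<m}" I "\<lambda>(j, k) i. coeff (coeff (f i) j) k"] assms(1)
    by (auto simp: case_prod_beta)
  have "coeff (coeff (\<Sum>i\<in>I. smult [:x i:] (f i)) j) k = 0" for j k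
  proof -
    have *: "coeff (coeff (\<Sum>i\<in>I. smult [:x i:] (f i)) j) k = (\<Sum>i\<in>I. coeff (coeff (f i) j) k * x i)"
      by (simp add: coeff_sum mult.commute)
    show ?thesis
    proof (cases "j < n \<and> k < m")
      case True then show ?thesis using eq * by auto
    next
      case False then show ?thesis unfolding * using deg ideg
        by (intro sum.neutral) (auto simp: not_less)
    qed
  qed
  then have "(\<Sum>i\<in>I. smult [:x i:] (f i)) = 0" by (simp add: poly_eq_iff)
  with x show ?thesis by blast
qed

lemma eval2_altdef: "eval2 P z w = poly (map_poly (\<lambda>q. poly q z) P) w"
  by (induction P) (auto simp: eval2_def map_poly_pCons)

text \<open>
  If both polynomials vanish identically on a line \<open>z = const\<close>, the equation of the line divides
  them both.
\<close>

lemma coprime_specialization_nonzero: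
  fixes P Q :: "complex poly poly"
  assumes "coprime P Q"
  shows "map_poly (\<lambda>q. poly q z) P \<noteq> 0 \<or> map_poly (\<lambda>q. poly q z) Q \<noteq> 0"
proof (rule ccontr)
  have dvd: "[:[:- z, 1:]:] dvd R" if "map_poly (\<lambda>q. poly q z) R = 0" for R :: "complex poly poly"
  proof -
    have "poly (coeff R n) z = 0" for n
      using that by (metis coeff_0 coeff_map_poly poly_0)
    then show ?thesis by (simp add: const_poly_dvd_iff poly_eq_0_iff_dvd)
  qed
  assume "\<not> ?thesis"
  then have "is_unit [:[:- z, 1:]:]" using dvd assms by (metis coprime_common_divisor)
  then have "is_unit [:- z, 1:]" by (simp only: is_unit_const_poly_iff)
  then show False by (subst (asm) is_unit_iff_degree) auto
qed

lemma coprime_common_zeros_fibre: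
  fixes P Q :: "complex poly poly"
  assumes "coprime P Q" and W: "\<And>w. w \<in> W \<Longrightarrow> eval2 P z w = 0 \<and> eval2 Q z w = 0"
  shows "card W \<le> max (degree P) (degree Q)"
proof -
  have bound: "card W \<le> degree R"
    if "map_poly (\<lambda>q. poly q z) R \<noteq> 0" "\<And>w. w \<in> W \<Longrightarrow> eval2 R z w = 0" for R
  proof -
    let ?R = "map_poly (\<lambda>q. poly q z) R"
    have "card W \<le> card {w. poly ?R w = 0}"
      using that by (intro card_mono poly_roots_finite) (auto simp: eval2_altdef)
    also have "\<dots> \<le> degree ?R" using that by (intro card_poly_roots_bound)
    also have "\<dots> \<le> degree R" by (rule map_poly_degree_leq)
    finally show ?thesis .
  qed
  show ?thesis
    using coprime_specialization_nonzero[OF assms(1), of z]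
  proof
    assume "map_poly (\<lambda>q. poly q z) P \<noteq> 0"
    from bound[OF this] W show ?thesis by simp
  next
    assume "map_poly (\<lambda>q. poly q z) Q \<noteq> 0"
    from bound[OF this] W show ?thesis by simp
  qed
qed

section \<open>Bezout's theorem\<close>

text \<open>
  Let \<open>a\<close> and \<open>b\<close> be the degrees of \<open>P\<close> and \<open>Q\<close> in \<open>w\<close>. Consider the combinations
  \<open>A P + B Q + (\<Sum>p\<in>Z. c\<^sub>p L\<^sub>p)\<close>, where \<open>A\<close> and \<open>B\<close> have degrees less than \<open>b\<close> and \<open>a\<close> in \<open>w\<close> and
  degree less than \<open>K\<close> in \<open>z\<close>, and \<open>L\<^sub>p\<close> vanishes on \<open>Z\<close> except at \<open>p\<close>. A combination which is zero
  has zero coefficients: evaluation on \<open>Z\<close> gives \<open>c = 0\<close>, and then \<open>Q\<close> divides \<open>A\<close>, so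
  \<open>A = 0\<close> and \<open>B = 0\<close> by degree. All of this takes place among the polynomials of
  degree less than \<open>a + b\<close> in \<open>w\<close> and less than \<open>K + d\<close> in \<open>z\<close>, so
  \<open>(a + b) K + card Z \<le> (a + b) (K + d)\<close>. The polynomials \<open>L\<^sub>p\<close> have small enough degree in \<open>w\<close>
  because a line \<open>z = const\<close> contains few points of \<open>Z\<close>; for their degree in \<open>z\<close> there is room
  once \<open>K\<close> is large.
\<close>

lemma bezout_coprime:
  fixes P Q :: "complex poly poly"
  assumes cop: "coprime P Q" and nz: "P \<noteq> 0" "Q \<noteq> 0"
    and ideg: "inner_degree_le d P" "inner_degree_le d Q"
    and fin: "finite Z"
    and zeros: "\<And>z w. (z, w) \<in> Z \<Longrightarrow> eval2 P z w = 0 \<and> eval2 Q z w = 0"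
  shows "card Z \<le> (degree P + degree Q) * d"
proof (rule ccontr)
  assume "\<not> ?thesis"
  then have large: "(degree P + degree Q) * d < card Z" by simp
  define a b where "a = degree P" and "b = degree Q"
  define W where "W z = {w. (z, w) \<in> Z}" for z
  define L :: "complex \<times> complex \<Rightarrow> complex poly poly" where
    "L p = (\<Prod>z\<in>fst ` Z - {fst p}. [:[:- z, 1:]:]) * (\<Prod>w\<in>W (fst p) - {snd p}. [:[:- w:], 1:])" for p
  have finW: "finite (W z)" for z
  proof -
    have "W z \<subseteq> snd ` Z" by (force simp: W_def)
    then show ?thesis using fin finite_subset by blast
  qed
  have eval_L: "eval2 (L p) z w = (\<Prod>z'\<in>fst ` Z - {fst p}. z - z') * (\<Prod>w'\<in>W (fst p) - {snd p}. w - w')"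
    for p z w
    by (simp add: L_def eval2_prod) (simp add: eval2_def)
  have L_self: "eval2 (L p) (fst p) (snd p) \<noteq> 0" for p
    using fin finW by (auto simp: eval_L)
  have L_other: "eval2 (L p) (fst q) (snd q) = 0" if "p \<in> Z" "q \<in> Z" "p \<noteq> q" for p q
  proof (cases "fst p = fst q")
    case True
    then have "snd q \<in> W (fst p) - {snd p}" using that by (auto simp: W_def prod_eq_iff)
    then show ?thesis using finW[of "fst p"] by (auto simp: eval_L)
  next
    case False
    then have "fst q \<in> fst ` Z - {fst p}" using that by auto
    then show ?thesis using fin by (auto simp: eval_L)
  qed
  have deg_L: "degree (L p) < a + b" if "p \<in> Z" for p
  proof -
    have mem: "snd p \<in> W (fst p)" using that by (simp add: W_def)
    have "degree (L p) \<le> 0 + card (W (fst p) - {snd p})"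
    proof -
      have "degree (\<Prod>z\<in>fst ` Z - {fst p}. [:[:- z, 1:]:]) \<le> (\<Sum>z\<in>fst ` Z - {fst p}. degree [:[:- z, 1:]:])"
        using degree_prod_sum_le[of "fst ` Z - {fst p}" "\<lambda>z. [:[:- z, 1:]:]"] fin by (simp add: o_def)
      moreover have "degree (\<Prod>w\<in>W (fst p) - {snd p}. [:[:- w:], 1:]) \<le> (\<Sum>w\<in>W (fst p) - {snd p}. degree [:[:- w:], 1:])"
        using degree_prod_sum_le[of "W (fst p) - {snd p}" "\<lambda>w. [:[:- w:], 1:]"] finW by (simp add: o_def)
      ultimately show ?thesis unfolding L_def
        using degree_mult_le[of "\<Prod>z\<in>fst ` Z - {fst p}. [:[:- z, 1:]:]" "\<Prod>w\<in>W (fst p) - {snd p}. [:[:- w:], 1:]"]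
        by simp
    qed
    also have "\<dots> < card (W (fst p))" using card_Diff1_less[OF finW mem] by (simp only: add_0)
    also have "\<dots> \<le> max a b" unfolding a_def b_def
      by (rule coprime_common_zeros_fibre[OF cop]) (use zeros in \<open>auto simp: W_def\<close>)
    also have "\<dots> \<le> a + b" by simp
    finally show ?thesis .
  qed
  have "\<forall>p. \<exists>k. inner_degree_le k (L p)" using inner_degree_le_exists by blast
  then obtain l where l: "\<And>p. inner_degree_le (l p) (L p)" by metis
  define K where "K = Suc (\<Sum>p\<in>Z. l p)"
  have ideg_L: "degree (coeff (L p) j) < K + d" if "p \<in> Z" for p j
  proof -
    have "l p \<le> (\<Sum>p\<in>Z. l p)" using fin that by (simp add: member_le_sum)
    then show ?thesis using l[of p] unfolding inner_degree_le_def K_def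
      by (metis le_imp_less_Suc le_trans trans_less_add1)
  qed
  let ?IA = "{..<b} \<times> {..<K}" and ?IB = "{..<a} \<times> {..<K}"
  let ?I = "(?IA <+> ?IB) <+> Z"
  let ?m = "\<lambda>c (i, j). monom (monom c j) i :: complex poly poly"
  define f where "f t = (case t of Inl (Inl u) \<Rightarrow> ?m 1 u * P | Inl (Inr u) \<Rightarrow> ?m 1 u * Q | Inr p \<Rightarrow> L p)" for t
  have monom_bounds: "coeff (?m c u * R) n = 0" if "fst u + degree R < n" for c u R n
  proof -
    have "degree (?m c u * R) \<le> fst u + degree R"
      using degree_mult_le[of "?m c u" R] degree_monom_le[of "monom c (snd u)" "fst u"]
      by (simp add: case_prod_beta)
    then show ?thesis using that by (simp add: coeff_eq_0)
  qed
  have monom_ibounds: "coeff (coeff (?m c u * R) n) k = 0"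
    if "inner_degree_le d R" "snd u + d < k" for c u R n k
  proof -
    have "inner_degree_le (snd u) (?m c u)"
      by (simp add: inner_degree_le_def case_prod_beta degree_monom_le)
    then have "inner_degree_le (snd u + d) (?m c u * R)" using that inner_degree_le_mult by blast
    then show ?thesis using that unfolding inner_degree_le_def
      by (metis coeff_eq_0 le_less_trans)
  qed
  have "\<exists>x. (\<exists>t\<in>?I. x t \<noteq> 0) \<and> (\<Sum>t\<in>?I. smult [:x t:] (f t)) = 0"
  proof (rule bivariate_dependence)
    show "finite ?I" using fin by simp
    have "card ?I = (a + b) * K + card Z" using fin by (simp add: card_Plus algebra_simps)
    then show "(a + b) * (K + d) < card ?I" using large unfolding a_def b_def by (simp add: algebra_simps)
  next
    fix t j assume t: "t \<in> ?I" and j: "a + b \<le> j"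
    consider u where "u \<in> ?IA" "t = Inl (Inl u)" | u where "u \<in> ?IB" "t = Inl (Inr u)" | p where "p \<in> Z" "t = Inr p"
      using t by blast
    then show "coeff (f t) j = 0"
    proof cases
      case 1
      then show ?thesis using monom_bounds[of u P j 1] j by (auto simp: f_def a_def)
    next
      case 2
      then show ?thesis using monom_bounds[of u Q j 1] j by (auto simp: f_def b_def)
    next
      case 3
      then show ?thesis using deg_L[of p] j by (simp add: f_def coeff_eq_0)
    qed
  next
    fix t j k assume t: "t \<in> ?I" and k: "K + d \<le> k"
    consider u where "u \<in> ?IA" "t = Inl (Inl u)" | u where "u \<in> ?IB" "t = Inl (Inr u)" | p where "p \<in> Z" "t = Inr p"
      using t by blast
    then show "coeff (coeff (f t) j) k = 0"
    proof cases
      case 1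
      then show ?thesis using monom_ibounds[OF ideg(1), of u k 1 j] k by (auto simp: f_def)
    next
      case 2
      then show ?thesis using monom_ibounds[OF ideg(2), of u k 1 j] k by (auto simp: f_def)
    next
      case 3
      then show ?thesis using ideg_L[of p j] k by (simp add: f_def coeff_eq_0)
    qed
  qed
  then obtain x where x: "\<exists>t\<in>?I. x t \<noteq> 0" and sum0: "(\<Sum>t\<in>?I. smult [:x t:] (f t)) = 0" by blast
  define A where "A = (\<Sum>u\<in>?IA. ?m (x (Inl (Inl u))) u)"
  define B where "B = (\<Sum>u\<in>?IB. ?m (x (Inl (Inr u))) u)"
  have smult_m: "smult [:c:] (?m 1 u * R) = ?m c u * R" for c u R
    by (simp add: case_prod_beta smult_monom flip: mult_smult_left)
  have comb: "A * P + B * Q + (\<Sum>p\<in>Z. smult [:x (Inr p):] (L p)) = 0"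
  proof -
    have "(\<Sum>t\<in>?I. smult [:x t:] (f t)) = (\<Sum>u\<in>?IA. smult [:x (Inl (Inl u)):] (?m 1 u * P)) +
      (\<Sum>u\<in>?IB. smult [:x (Inl (Inr u)):] (?m 1 u * Q)) + (\<Sum>p\<in>Z. smult [:x (Inr p):] (L p))"
      using fin by (simp add: sum.Plus f_def)
    then show ?thesis using sum0 unfolding smult_m A_def B_def sum_distrib_right by simp
  qed
  \<comment> \<open>All terms but one of the combination vanish at \<open>p\<close>.\<close>
  have xZ: "x (Inr p) = 0" if "p \<in> Z" for p
  proof -
    have "eval2 P (fst p) (snd p) = 0" "eval2 Q (fst p) (snd p) = 0" using zeros[of "fst p" "snd p"] that by auto
    then have "(\<Sum>q\<in>Z. x (Inr q) * eval2 (L q) (fst p) (snd p)) = 0"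
      using arg_cong[OF comb, of "\<lambda>R. eval2 R (fst p) (snd p)"] by (simp add: eval2_sum)
    moreover have "(\<Sum>q\<in>Z. x (Inr q) * eval2 (L q) (fst p) (snd p)) =
      x (Inr p) * eval2 (L p) (fst p) (snd p) + (\<Sum>q\<in>Z - {p}. x (Inr q) * eval2 (L q) (fst p) (snd p))"
      using fin that by (simp add: sum.remove)
    moreover have "(\<Sum>q\<in>Z - {p}. x (Inr q) * eval2 (L q) (fst p) (snd p)) = 0"
      using L_other that by (intro sum.neutral) auto
    ultimately show ?thesis using L_self[of p] by simp
  qed
  then have AB: "A * P + B * Q = 0" using comb by simp
  have coeff_m: "coeff (coeff (\<Sum>u\<in>{..<r} \<times> {..<K}. ?m (y u) u) i) j = (if i < r \<and> j < K then y (i, j) else 0)"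
    for r y i j
  proof -
    have "coeff (coeff (\<Sum>u\<in>{..<r} \<times> {..<K}. ?m (y u) u) i) j = (\<Sum>u\<in>{..<r} \<times> {..<K}. if u = (i, j) then y u else 0)"
      unfolding coeff_sum by (rule sum.cong) (auto split: if_splits)
    then show ?thesis by simp
  qed
  have small: "R dvd S \<Longrightarrow> S = 0" if "\<And>i. degree R \<le> i \<Longrightarrow> coeff S i = 0" for R S :: "complex poly poly"
    using that dvd_imp_degree_le[of R S] by (metis leading_coeff_0_iff)
  have "Q dvd A * P" using AB by (metis add_eq_0_iff dvd_minus_iff dvd_triv_right minus_minus)
  then have "Q dvd A" using cop by (metis coprime_commute coprime_dvd_mult_left_iff)
  then have A0: "A = 0" by (rule small[rotated]) (auto simp: poly_eq_iff A_def b_def coeff_m)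
  then have B0: "B = 0" using AB nz by simp
  have "x (Inl (Inl u)) = 0" if "u \<in> ?IA" for u
    using coeff_m[where r = b and y = "\<lambda>u. x (Inl (Inl u))" and i = "fst u" and j = "snd u"] A0 that unfolding A_def[symmetric] by auto
  moreover have "x (Inl (Inr u)) = 0" if "u \<in> ?IB" for u
    using coeff_m[where r = a and y = "\<lambda>u. x (Inl (Inr u))" and i = "fst u" and j = "snd u"] B0 that unfolding B_def[symmetric] by auto
  ultimately show False using x xZ by auto
qed

section \<open>Trigonometric polynomials on the torus\<close>

lemma e_add: "e (s + t) = e s * e t"
  by (simp add: e_def exp_add ring_distribs)

lemma e_0 [simp]: "e 0 = 1"
  by (simp add: e_def)

lemma e_nonzero [simp]: "e t \<noteq> 0"
  by (simp add: e_def)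

lemma e_of_nat_mult: "e (real n * t) = e t ^ n"
  by (induction n) (simp_all add: e_add ring_distribs)

lemma e_eq_imp_Ints: 
  assumes "e s = e t"
  shows "s - t \<in> \<int>"
proof -
  from assms obtain n :: int where
    "2 * complex_of_real pi * \<i> * complex_of_real s = 2 * complex_of_real pi * \<i> * complex_of_real t + (of_int (2 * n) * pi) * \<i>"
    unfolding e_def exp_eq by blast
  then have "2 * pi * \<i> * (complex_of_real s - complex_of_real t - of_int n) = 0" 
    by (simp add: algebra_simps)
  then have "complex_of_real (s - t) = complex_of_real (of_int n)" by simp
  then have "s - t = of_int n" by (simp only: of_real_eq_iff)
  then show ?thesis by simp
qed

lemma e_compose_has_derivative:
  fixes f f' :: "'a::real_normed_vector \<Rightarrow> real"
  assumes "(f has_derivative f') (at x within S)"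
  shows "((\<lambda>x. e (f x)) has_derivative (\<lambda>v. 2 * pi * \<i> * f' v * e (f x))) (at x within S)"
proof -
  have 1: "((\<lambda>x. 2 * complex_of_real pi * \<i> * complex_of_real (f x)) has_derivative
      (\<lambda>v. 2 * complex_of_real pi * \<i> * complex_of_real (f' v))) (at x within S)"
    by (intro derivative_intros assms)
  have 2: "(exp has_field_derivative exp (2 * complex_of_real pi * \<i> * complex_of_real (f x)))
      (at (2 * complex_of_real pi * \<i> * complex_of_real (f x)))"
    by (rule DERIV_exp)
  from has_derivative_compose[OF 1 has_field_derivative_imp_has_derivative[OF 2]] show ?thesis unfolding e_def by (simp add: mult_ac)
qed

definition torus_eval :: "complex poly poly \<Rightarrow> real ^ 2 \<Rightarrow> complex" where
  "torus_eval R x = eval2 R (e (x $ 1)) (e (x $ 2))"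

lemma e_component_differentiable: "(\<lambda>x :: real ^ 2. e (x $ i)) differentiable (at x)"
  using e_compose_has_derivative[of "\<lambda>x. x $ i" "\<lambda>x. x $ i" x UNIV]
  by (auto simp: differentiable_def intro: bounded_linear_imp_has_derivative bounded_linear_vec_nth)

lemma torus_eval_differentiable: "torus_eval R differentiable (at x)"
proof -
  have inner: "(\<lambda>x :: real ^ 2. poly p (e (x $ i))) differentiable (at x)" for p i x
    by (induction p) (simp_all add: e_component_differentiable)
  have "(\<lambda>x. eval2 R (e (x $ 1)) (e (x $ 2))) differentiable (at x)"
    by (induction R) (simp_all add: eval2_def inner e_component_differentiable)
  then show ?thesis by (simp add: torus_eval_def[abs_def])
qed

lemma torus_eval_mult: "torus_eval (R * S) = (\<lambda>x. torus_eval R x * torus_eval S x)"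
  by (simp add: torus_eval_def fun_eq_iff)

text \<open>
  At a zero of \<open>D\<close> the derivatives of \<open>D P\<close> and \<open>D Q\<close> are both multiples of the derivative of \<open>D\<close>,
  which contradicts the nondegeneracy. The latter is expressed by a vector \<open>v\<close> in the kernel of
  \<open>P'\<close>, but not of \<open>Q'\<close>, and a vector \<open>n\<close> outside the kernel of \<open>P'\<close>.
\<close>

lemma gcd_nonzero_at_nondegenerate_zero:
  assumes P: "(torus_eval (D * P) has_derivative P') (at x)"
    and Q: "(torus_eval (D * Q) has_derivative Q') (at x)"
    and nd: "P' v = 0" "P' n \<noteq> 0" "Q' v \<noteq> 0"
  shows "torus_eval D x \<noteq> 0"
proof
  assume D0: "torus_eval D x = 0"
  obtain D' where D': "(torus_eval D has_derivative D') (at x)"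
    using torus_eval_differentiable differentiable_def by blast
  have der: "T' = (\<lambda>v. D' v * torus_eval R x)" if T': "(torus_eval (D * R) has_derivative T') (at x)" for R T'
  proof -
    obtain R' where R': "(torus_eval R has_derivative R') (at x)"
      using torus_eval_differentiable differentiable_def by blast
    from has_derivative_mult[OF D' R'] have "(torus_eval (D * R) has_derivative (\<lambda>v. D' v * torus_eval R x)) (at x)"
      by (simp add: torus_eval_mult D0)
    then show ?thesis using T' has_derivative_unique by blast
  qed
  have "P' = (\<lambda>v. D' v * torus_eval P x)" "Q' = (\<lambda>v. D' v * torus_eval Q x)"
    using der P Q by blast+
  with nd show False by auto
qed

lemma bezout_nondegenerate:
  fixes P Q :: "complex poly poly"
  assumes deg: "degree P \<le> d" "degree Q \<le> d" "inner_degree_le d P" "inner_degree_le d Q"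
    and fin: "finite X" and inj: "\<And>x y. x \<in> X \<Longrightarrow> y \<in> X \<Longrightarrow> torus_eq x y \<Longrightarrow> x = y"
    and zero: "\<And>x. x \<in> X \<Longrightarrow> torus_eval P x = 0 \<and> torus_eval Q x = 0"
    and nd: "\<And>x. x \<in> X \<Longrightarrow> \<exists>P' Q' v n. (torus_eval P has_derivative P') (at x) \<and>
      (torus_eval Q has_derivative Q') (at x) \<and> P' v = 0 \<and> P' n \<noteq> 0 \<and> Q' v \<noteq> 0"
  shows "card X \<le> 2 * d * d"
proof (cases "X = {}")
  case False
  then obtain x0 where x0: "x0 \<in> X" by blast
  have const0: "torus_eval 0 = (\<lambda>_. 0)" by (simp add: torus_eval_def fun_eq_iff)
  have nz: "P \<noteq> 0" "Q \<noteq> 0"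
    using nd[OF x0] const0 has_derivative_unique[OF _ has_derivative_const, of 0 _ x0] by fastforce+
  define D where "D = gcd P Q"
  have "D \<noteq> 0" using nz by (simp add: D_def)
  then obtain P1 Q1 where PQ: "P = D * P1" "Q = D * Q1" and cop: "coprime P1 Q1"
    unfolding D_def using gcd_coprime_exists[of P Q] by (metis mult.commute)
  have nz1: "P1 \<noteq> 0" "Q1 \<noteq> 0" using nz PQ by auto
  have deg1: "degree P1 \<le> d" "degree Q1 \<le> d"
    using deg nz1 \<open>D \<noteq> 0\<close> by (simp_all add: PQ degree_mult_eq)
  have ideg1: "inner_degree_le d P1" "inner_degree_le d Q1"
    using deg \<open>D \<noteq> 0\<close> inner_degree_le_factor PQ by blast+
  let ?pt = "\<lambda>x :: real ^ 2. (e (x $ 1), e (x $ 2))"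
  have "inj_on ?pt X"
  proof (rule inj_onI)
    fix x y assume "x \<in> X" "y \<in> X" "?pt x = ?pt y"
    moreover from this have "torus_eq x y" by (auto simp: torus_eq_def forall_2 e_eq_imp_Ints)
    ultimately show "x = y" using inj by blast
  qed
  then have "card X = card (?pt ` X)" by (simp add: card_image)
  also have "\<dots> \<le> (degree P1 + degree Q1) * d"
  proof (rule bezout_coprime[OF cop nz1 ideg1])
    fix z w assume "(z, w) \<in> ?pt ` X"
    then obtain x where x: "x \<in> X" "z = e (x $ 1)" "w = e (x $ 2)" by auto
    have "torus_eval D x \<noteq> 0"
      using nd[OF x(1)] gcd_nonzero_at_nondegenerate_zero PQ by metis
    then show "eval2 P1 z w = 0 \<and> eval2 Q1 z w = 0"
      using zero[OF x(1)] x by (simp add: PQ torus_eval_mult) (simp add: torus_eval_def)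
  qed (use fin in simp)
  also have "\<dots> \<le> (d + d) * d" using deg1 by (intro mult_le_mono1 add_mono)
  finally show ?thesis by (simp add: algebra_simps)
qed simp

abbreviation real_vec :: "int ^ 2 \<Rightarrow> real ^ 2" where
  "real_vec \<xi> \<equiv> (\<chi> i. real_of_int (\<xi> $ i))"

definition trig :: "(int ^ 2) set \<Rightarrow> (int ^ 2 \<Rightarrow> complex) \<Rightarrow> real ^ 2 \<Rightarrow> complex" where
  "trig F a x = (\<Sum>\<xi>\<in>F. a \<xi> * e (x \<bullet> real_vec \<xi>))"

definition dir_deriv :: "real ^ 2 \<Rightarrow> (int ^ 2 \<Rightarrow> complex) \<Rightarrow> int ^ 2 \<Rightarrow> complex" where
  "dir_deriv v a \<xi> = a \<xi> * (2 * pi * \<i> * (v \<bullet> real_vec \<xi>))"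

lemma trig_has_derivative:
  "(trig F a has_derivative (\<lambda>v. trig F (dir_deriv v a) x)) (at x within S)"
proof -
  have "((\<lambda>x. \<Sum>\<xi>\<in>F. a \<xi> * e (x \<bullet> real_vec \<xi>)) has_derivative
      (\<lambda>v. \<Sum>\<xi>\<in>F. a \<xi> * (2 * pi * \<i> * (v \<bullet> real_vec \<xi>) * e (x \<bullet> real_vec \<xi>)))) (at x within S)"
    by (intro has_derivative_sum has_derivative_mult_right e_compose_has_derivative
        has_derivative_inner_left has_derivative_ident)
  then show ?thesis by (simp add: trig_def[abs_def] dir_deriv_def mult_ac)
qed

lemma dir_deriv_linear: "trig F (dir_deriv (s *\<^sub>R v + t *\<^sub>R w) a) x =
    s * trig F (dir_deriv v a) x + t * trig F (dir_deriv w a) x"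
  by (simp add: trig_def dir_deriv_def inner_simps sum_distrib_left sum.distrib algebra_simps)

definition trig_poly :: "nat \<Rightarrow> (int ^ 2) set \<Rightarrow> (int ^ 2 \<Rightarrow> complex) \<Rightarrow> complex poly poly" where
  "trig_poly M F a = (\<Sum>\<xi>\<in>F. monom (monom (a \<xi>) (nat (\<xi> $ 1 + int M))) (nat (\<xi> $ 2 + int M)))"

text \<open>
  The factor \<open>e (M (x\<^sub>1 + x\<^sub>2))\<close> makes all exponents nonnegative. It has no zeros, so the zeros and
  their nondegeneracy are those of the trigonometric polynomial.
\<close>

lemma torus_eval_trig_poly:
  assumes "\<And>\<xi> i. \<xi> \<in> F \<Longrightarrow> \<bar>\<xi> $ i\<bar> \<le> int M"
  shows "torus_eval (trig_poly M F a) x = e (real M * (x $ 1 + x $ 2)) * trig F a x"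
proof -
  have "a \<xi> * e (x $ 1) ^ nat (\<xi> $ 1 + int M) * e (x $ 2) ^ nat (\<xi> $ 2 + int M) =
      e (real M * (x $ 1 + x $ 2)) * (a \<xi> * e (x \<bullet> real_vec \<xi>))" if "\<xi> \<in> F" for \<xi>
  proof -
    have "\<bar>\<xi> $ 1\<bar> \<le> int M" "\<bar>\<xi> $ 2\<bar> \<le> int M" using assms that by blast+
    then have r: "real (nat (\<xi> $ 1 + int M)) = \<xi> $ 1 + real M" "real (nat (\<xi> $ 2 + int M)) = \<xi> $ 2 + real M"
      by auto
    have i: "x \<bullet> real_vec \<xi> = x $ 1 * \<xi> $ 1 + x $ 2 * \<xi> $ 2" by (simp add: inner_vec_def sum_2)
    show ?thesis unfolding e_of_nat_mult[symmetric] i mult.assoc e_add[symmetric] r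
      by (simp only: mult.left_commute[of _ "a \<xi>"] e_add[symmetric]) (simp add: algebra_simps)
  qed
  then show ?thesis
    unfolding torus_eval_def trig_poly_def trig_def eval2_sum sum_distrib_left eval2_simps
    by (intro sum.cong refl)
qed

lemma trig_poly_degree:
  assumes "\<And>\<xi> i. \<xi> \<in> F \<Longrightarrow> \<bar>\<xi> $ i\<bar> \<le> int M"
  shows "degree (trig_poly M F a) \<le> 2 * M" "inner_degree_le (2 * M) (trig_poly M F a)"
proof -
  have le: "nat (\<xi> $ i + int M) \<le> 2 * M" if "\<xi> \<in> F" for \<xi> i
    using assms[OF that, of i] by auto
  have 1: "degree (monom c (nat (\<xi> $ i + int M))) \<le> 2 * M" if "\<xi> \<in> F" for \<xi> i and c :: "'b::zero"
    using le[OF that, of i] degree_monom_le[of c "nat (\<xi> $ i + int M)"] by linarith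
  show "degree (trig_poly M F a) \<le> 2 * M" unfolding trig_poly_def
  proof (cases "finite F")
    case True then show "degree (\<Sum>\<xi>\<in>F. monom (monom (a \<xi>) (nat (\<xi> $ 1 + int M))) (nat (\<xi> $ 2 + int M))) \<le> 2 * M"
      using 1 by (intro degree_sum_le) auto
  qed simp
  show "inner_degree_le (2 * M) (trig_poly M F a)" 
  proof (cases "finite F")
    case True
    then show ?thesis unfolding trig_poly_def inner_degree_le_def coeff_sum using 1
      by (intro allI degree_sum_le) auto
  qed (simp add: inner_degree_le_def trig_poly_def)
qed

lemma nondegenerate_trig_zeros:
  assumes F: "\<And>\<xi> i. \<xi> \<in> F \<Longrightarrow> \<bar>\<xi> $ i\<bar> \<le> int M"
    and fin: "finite X" and inj: "\<And>x y. x \<in> X \<Longrightarrow> y \<in> X \<Longrightarrow> torus_eq x y \<Longrightarrow> x = y"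
    and zero: "\<And>x. x \<in> X \<Longrightarrow> trig F a x = 0 \<and> trig F b x = 0"
    and nd: "\<And>x. x \<in> X \<Longrightarrow> \<exists>v n. trig F (dir_deriv v a) x = 0 \<and> trig F (dir_deriv n a) x \<noteq> 0 \<and>
      trig F (dir_deriv v b) x \<noteq> 0"
  shows "card X \<le> 8 * M\<^sup>2"
proof -
  have der: "(torus_eval (trig_poly M F c) has_derivative
      (\<lambda>v. e (real M * (x $ 1 + x $ 2)) * trig F (dir_deriv v c) x)) (at x)" if "trig F c x = 0" for c x
  proof -
    have ev: "torus_eval (trig_poly M F c) = (\<lambda>x. e (real M * (x $ 1 + x $ 2)) * trig F c x)"
      using torus_eval_trig_poly F by blast
    have lin: "((\<lambda>x :: real ^ 2. real M * (x $ 1 + x $ 2)) has_derivative (\<lambda>x. real M * (x $ 1 + x $ 2))) (at x)"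
      by (intro has_derivative_mult_right has_derivative_add bounded_linear_imp_has_derivative bounded_linear_vec_nth)
    show ?thesis unfolding ev
      using has_derivative_mult[OF e_compose_has_derivative[OF lin] trig_has_derivative[of F c x]] that by simp
  qed
  have "card X \<le> 2 * (2 * M) * (2 * M)"
  proof (rule bezout_nondegenerate[where P = "trig_poly M F a" and Q = "trig_poly M F b"])
    fix x assume x: "x \<in> X"
    show "torus_eval (trig_poly M F a) x = 0 \<and> torus_eval (trig_poly M F b) x = 0"
      using zero[OF x] torus_eval_trig_poly[OF F] by simp
    from nd[OF x] obtain v n where vn: "trig F (dir_deriv v a) x = 0" "trig F (dir_deriv n a) x \<noteq> 0"
      "trig F (dir_deriv v b) x \<noteq> 0" by blast
    have "trig F a x = 0" "trig F b x = 0" using zero[OF x] by blast+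
    note der[OF this(1)] der[OF this(2)]
    moreover have "e (real M * (x $ 1 + x $ 2)) * trig F (dir_deriv v a) x = 0"
      "e (real M * (x $ 1 + x $ 2)) * trig F (dir_deriv n a) x \<noteq> 0"
      "e (real M * (x $ 1 + x $ 2)) * trig F (dir_deriv v b) x \<noteq> 0"
      using vn by simp_all
    ultimately show "\<exists>P' Q' v n. (torus_eval (trig_poly M F a) has_derivative P') (at x) \<and>
      (torus_eval (trig_poly M F b) has_derivative Q') (at x) \<and> P' v = 0 \<and> P' n \<noteq> 0 \<and> Q' v \<noteq> 0"
      by (intro exI conjI)
  qed (use trig_poly_degree[OF F] fin inj in auto)
  then show ?thesis by (simp add: power2_eq_square)
qed

lemma freqs_bound: 
  assumes "\<xi> \<in> freqs E" "real E < (real M + 1)\<^sup>2"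
  shows "\<bar>\<xi> $ i\<bar> \<le> int M"
proof -
  have "(\<xi> $ i)\<^sup>2 \<le> (\<Sum>i\<in>UNIV. (\<xi> $ i)\<^sup>2)"
    by (rule member_le_sum) auto
  also have "\<dots> = int E" using assms by (simp add: freqs_def)
  also have "int E < (int M + 1)\<^sup>2"
  proof -
    have "real_of_int (int E) < real_of_int ((int M + 1)\<^sup>2)" using assms(2) by simp
    then show ?thesis by (simp only: of_int_less_iff)
  qed
  finally have "\<bar>\<xi> $ i\<bar>\<^sup>2 < (int M + 1)\<^sup>2" by simp
  then have "\<bar>\<xi> $ i\<bar> < int M + 1" by (rule power_less_imp_less_base) simp
  then show ?thesis by simp
qed

section \<open>Variation and multiplicity\<close>

lemma piece_index_eq_floor:
  fixes s l :: real
  assumes "0 < l" "0 < m" "s \<in> {real j * l / real m<..<real (Suc j) * l / real m}"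
  shows "nat \<lfloor>s * real m / l\<rfloor> = j"
proof -
  have "real j \<le> s * real m / l" "s * real m / l < real j + 1"
    using assms by (auto simp: field_simps)
  then have "\<lfloor>s * real m / l\<rfloor> = int j" by (simp add: floor_eq_iff)
  then show ?thesis by simp
qed

text \<open>
  Cut \<open>[0, l]\<close> into \<open>m\<close> equal pieces. On a fine partition \<open>h'\<close> is almost constant on each piece, so
  the variation over a piece is close to the absolute difference of \<open>h\<close> at its ends, and it is small
  on a piece where \<open>h'\<close> has a zero. The few pieces that meet \<open>F\<close> have small total length.
  Hence only the pieces in \<open>G\<close>, those without zeros of \<open>h'\<close> and points of \<open>F\<close> inside, count.
\<close>

lemma variation_by_pieces:
  fixes h h' :: "real \<Rightarrow> real"
  assumes l: "0 < l"
    and der: "\<And>s. s \<in> {0..l} \<Longrightarrow> (h has_real_derivative h' s) (at s within {0..l})"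
    and cont: "continuous_on {0..l} h'" and F: "finite F" and eps: "0 < \<epsilon>"
  obtains m G where "0 < m" "G \<subseteq> {..<m}"
    "\<And>j s. j \<in> G \<Longrightarrow> s \<in> {real j * l / real m<..<real (Suc j) * l / real m} \<Longrightarrow> s \<notin> F \<and> h' s \<noteq> 0"
    "integral {0..l} (\<lambda>s. \<bar>h' s\<bar>) \<le>
       (\<Sum>j\<in>G. \<bar>h (real (Suc j) * l / real m) - h (real j * l / real m)\<bar>) + \<epsilon>"
proof -
  have "uniformly_continuous_on {0..l} h'" using cont by (simp add: compact_uniformly_continuous)
  moreover define \<epsilon>1 where "\<epsilon>1 = \<epsilon> / (2 * l)"
  moreover have eps1: "0 < \<epsilon>1" using eps l by (simp add: \<epsilon>1_def)
  ultimately obtain \<delta> where \<delta>: "0 < \<delta>"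
    "\<And>s t. s \<in> {0..l} \<Longrightarrow> t \<in> {0..l} \<Longrightarrow> \<bar>s - t\<bar> < \<delta> \<Longrightarrow> \<bar>h' s - h' t\<bar> < \<epsilon>1"
    unfolding uniformly_continuous_on_def dist_real_def by metis
  have "bounded (h' ` {0..l})"
    by (intro compact_imp_bounded compact_continuous_image cont compact_Icc)
  then obtain B where B: "0 < B" "\<And>s. s \<in> {0..l} \<Longrightarrow> \<bar>h' s\<bar> \<le> B"
    unfolding bounded_pos by auto
  obtain m :: nat where m: "l / \<delta> + 2 * card F * B * l / \<epsilon> < m" using reals_Archimedean2 by blast
  have pos: "0 < l / \<delta>" "0 \<le> 2 * card F * B * l / \<epsilon>" using l \<delta> B eps by auto
  then have m0: "0 < m" using m by (metis add_pos_nonneg of_nat_0_less_iff less_trans)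
  have "l / \<delta> < m" "2 * card F * B * l / \<epsilon> \<le> m" using m pos by linarith+
  then have fine: "l / m < \<delta>" and few: "card F * (B * (l / m)) \<le> \<epsilon> / 2"
    using m0 \<delta> eps by (auto simp: field_simps)
  define t where "t j = real j * l / real m" for j
  have t_Suc: "t (Suc j) = t j + l / m" for j by (simp add: t_def algebra_simps add_divide_distrib)
  have t_mono: "t i \<le> t j" if "i \<le> j" for i j
    using that l by (simp add: t_def divide_right_mono mult_right_mono)
  have t0: "t 0 = 0" and tm: "t m = l" using m0 by (simp_all add: t_def)
  have sub: "{t j..t (Suc j)} \<subseteq> {0..l}" if "j < m" for j
    using t_mono[of 0 j] t_mono[of "Suc j" m] that by (auto simp: t0 tm)
  have tlt: "t j < t (Suc j)" for j using l m0 by (simp add: t_Suc)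
  have int: "(\<lambda>s. \<bar>h' s\<bar>) integrable_on {0..l}"
    by (intro integrable_continuous_real continuous_intros cont)
  define G where "G = {j. j < m \<and> (\<forall>s\<in>{t j<..<t (Suc j)}. s \<notin> F \<and> h' s \<noteq> 0)}"
  define H where "H = {j. j < m \<and> (\<exists>s\<in>{t j<..<t (Suc j)}. s \<in> F)}"
  have "H \<subseteq> (\<lambda>s. nat \<lfloor>s * real m / l\<rfloor>) ` F"
  proof
    fix j assume "j \<in> H"
    then obtain s where "s \<in> {t j<..<t (Suc j)}" "s \<in> F" by (auto simp: H_def)
    then show "j \<in> (\<lambda>s. nat \<lfloor>s * real m / l\<rfloor>) ` F"
      using piece_index_eq_floor[OF l m0, of s j] by (force simp: t_def)
  qed
  then have cardH: "card H \<le> card F" by (rule surj_card_le[OF F])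
  let ?I = "\<lambda>j. integral {t j..t (Suc j)} (\<lambda>s. \<bar>h' s\<bar>)"
  have bound: "?I j \<le> c * (l / m)" if "j < m" "\<And>s. s \<in> {t j..t (Suc j)} \<Longrightarrow> \<bar>h' s\<bar> \<le> c" for j c
  proof -
    have "?I j \<le> integral {t j..t (Suc j)} (\<lambda>_. c)"
      using that sub integrable_on_subinterval[OF int] by (intro integral_le) auto
    also have "\<dots> = c * (l / m)" using tlt[of j] by (simp add: t_Suc mult.commute)
    finally show ?thesis .
  qed
  have close: "\<bar>h' s\<bar> \<le> \<bar>h' u\<bar> + \<epsilon>1" if "j < m" "s \<in> {t j..t (Suc j)}" "u \<in> {t j..t (Suc j)}" for j s u
  proof -
    have "\<bar>s - u\<bar> \<le> l / m" using that by (auto simp: t_Suc)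
    then have "\<bar>h' s - h' u\<bar> < \<epsilon>1" using that sub[of j] fine by (intro \<delta>) auto
    then show ?thesis by linarith
  qed
  have piece: "?I j \<le> (if j \<in> G then \<bar>h (t (Suc j)) - h (t j)\<bar> else 0) + \<epsilon>1 * (l / m) +
      (if j \<in> H then B * (l / m) else 0)" if j: "j < m" for j
  proof -
    have nn: "0 \<le> \<epsilon>1 * (l / m)" "0 \<le> B * (l / m)" using eps1 l B by simp_all
    consider "j \<in> G" | "j \<in> H" "j \<notin> G" | u where "j \<notin> H" "j \<notin> G" "u \<in> {t j<..<t (Suc j)}" "h' u = 0"
      using j unfolding G_def H_def by blast
    then show ?thesis
    proof cases
      case 1
      have "\<exists>u\<in>{t j..t (Suc j)}. h (t (Suc j)) - h (t j) = (*) (h' u) (t (Suc j) - t j)"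
      proof (rule mvt_very_simple)
        fix u assume "t j \<le> u" "u \<le> t (Suc j)"
        then have "(h has_real_derivative h' u) (at u within {t j..t (Suc j)})"
          using sub[OF j] by (intro DERIV_subset[OF der]) auto
        then show "(h has_derivative (*) (h' u)) (at u within {t j..t (Suc j)})"
          by (simp add: has_field_derivative_def)
      qed (use tlt[of j] in simp)
      then obtain u where u: "u \<in> {t j..t (Suc j)}" "h (t (Suc j)) - h (t j) = (l / m) * h' u"
        by (auto simp: t_Suc mult.commute)
      have "?I j \<le> (\<bar>h' u\<bar> + \<epsilon>1) * (l / m)" using close[OF j _ u(1)] by (intro bound j)
      also have "\<dots> = \<bar>h (t (Suc j)) - h (t j)\<bar> + \<epsilon>1 * (l / m)"
        using l by (simp add: u(2) abs_mult algebra_simps add_divide_distrib)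
      finally show ?thesis using 1 nn by simp
    next
      case 2
      have "?I j \<le> B * (l / m)" using B sub[OF j] by (intro bound j) auto
      then show ?thesis using 2 nn by simp
    next
      case 3
      have "?I j \<le> \<epsilon>1 * (l / m)"
        using close[OF j, of _ u] 3 by (intro bound j) auto
      then show ?thesis using 3 nn by simp
    qed
  qed
  have "integral {0..t k} (\<lambda>s. \<bar>h' s\<bar>) = (\<Sum>j<k. ?I j)" if "k \<le> m" for k
    using that
  proof (induction k)
    case (Suc k)
    have "integral {0..t k} (\<lambda>s. \<bar>h' s\<bar>) + ?I k = integral {0..t (Suc k)} (\<lambda>s. \<bar>h' s\<bar>)"
    proof (rule Henstock_Kurzweil_Integration.integral_combine)
      show "(\<lambda>s. \<bar>h' s\<bar>) integrable_on {0..t (Suc k)}"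
        using t_mono[of "Suc k" m] Suc.prems tm by (intro integrable_on_subinterval[OF int]) auto
    qed (use t_mono[of 0 k] t_mono[of k "Suc k"] t0 in auto)
    then show ?case using Suc by simp
  qed (simp add: t0)
  then have "integral {0..l} (\<lambda>s. \<bar>h' s\<bar>) = (\<Sum>j<m. ?I j)" using tm by fastforce
  also have "\<dots> \<le> (\<Sum>j<m. (if j \<in> G then \<bar>h (t (Suc j)) - h (t j)\<bar> else 0) + \<epsilon>1 * (l / m) +
      (if j \<in> H then B * (l / m) else 0))"
    by (intro sum_mono piece) simp
  also have "\<dots> = (\<Sum>j\<in>{..<m} \<inter> G. \<bar>h (t (Suc j)) - h (t j)\<bar>) + m * (\<epsilon>1 * (l / m)) +
      card ({..<m} \<inter> H) * (B * (l / m))"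
    by (simp add: sum.distrib sum.inter_restrict[symmetric])
  also have "{..<m} \<inter> G = G" by (auto simp: G_def)
  also have "{..<m} \<inter> H = H" by (auto simp: H_def)
  also have "m * (\<epsilon>1 * (l / m)) = \<epsilon> / 2" using m0 l by (simp add: \<epsilon>1_def)
  also have "card H * (B * (l / m)) \<le> card F * (B * (l / m))"
    using cardH B l by (intro mult_right_mono) auto
  also note few
  finally have fin: "integral {0..l} (\<lambda>s. \<bar>h' s\<bar>) \<le> (\<Sum>j\<in>G. \<bar>h (t (Suc j)) - h (t j)\<bar>) + \<epsilon>"
    by simp
  show thesis
    by (rule that[of m G]) (use m0 fin in \<open>auto simp: G_def t_def\<close>)
qed

lemma sum_lengths_le:
  fixes p q :: "'k \<Rightarrow> real"
  assumes K: "finite K" and pq: "\<And>k. k \<in> K \<Longrightarrow> p k \<le> q k \<and> {p k<..<q k} \<subseteq> {a..b}" and "a \<le> b"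
    and mult: "\<And>c. card {k \<in> K. c \<in> {p k<..<q k}} \<le> N"
  shows "(\<Sum>k\<in>K. q k - p k) \<le> N * (b - a)"
proof -
  have int: "integrable lborel (indicator {p k<..<q k} :: real \<Rightarrow> real)" if "k \<in> K" for k
    using pq[OF that] by (intro integrable_real_indicator) auto
  have "(\<Sum>k\<in>K. q k - p k) = (\<Sum>k\<in>K. \<integral>c. indicator {p k<..<q k} c \<partial>lborel)"
    using pq by (intro sum.cong) auto
  also have "\<dots> = (\<integral>c. (\<Sum>k\<in>K. indicator {p k<..<q k} c) \<partial>lborel)"
    using int by (simp add: Bochner_Integration.integral_sum)
  also have "\<dots> \<le> (\<integral>c. real N * indicator {a..b} c \<partial>lborel)"
  proof (rule integral_mono)
    fix c
    show "(\<Sum>k\<in>K. indicator {p k<..<q k} c) \<le> real N * indicator {a..b} c"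
    proof (cases "c \<in> {a..b}")
      case True
      have "(\<Sum>k\<in>K. indicator {p k<..<q k} c) = real (card {k \<in> K. c \<in> {p k<..<q k}})"
        using K by (simp add: indicator_def sum.If_cases Int_def)
      then show ?thesis using mult[of c] True by simp
    next
      case False
      then have "indicator {p k<..<q k} c = (0 :: real)" if "k \<in> K" for k
        using pq[OF that] by (auto simp: indicator_def)
      then show ?thesis using False by simp
    qed
  next
    have "integrable lborel (indicator {a..b} :: real \<Rightarrow> real)"
      by (intro integrable_real_indicator) (auto simp: emeasure_lborel_Icc_eq)
    then show "integrable lborel (\<lambda>c. real N * indicator {a..b} c)" by simp
  qed (use int in auto)
  also have "\<dots> = N * (b - a)" using \<open>a \<le> b\<close> by simp
  finally show ?thesis .
qed

text \<open>
  Half of Banach's indicatrix theorem. By the intermediate value theorem, the variation over a good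
  piece is the length of an interval of values each of which is taken inside the piece; at most \<open>N\<close>
  of these intervals overlap. The hypothesis on \<open>N\<close> speaks of finite subsets because the \<open>card\<close> of an infinite level
  set would be \<open>0\<close>.
\<close>

lemma total_variation_le_multiplicity:
  fixes h h' :: "nat \<Rightarrow> real \<Rightarrow> real"
  assumes l: "\<And>i. i < n \<Longrightarrow> 0 < l i"
    and der: "\<And>i s. i < n \<Longrightarrow> s \<in> {0..l i} \<Longrightarrow> (h i has_real_derivative h' i s) (at s within {0..l i})"
    and cont: "\<And>i. i < n \<Longrightarrow> continuous_on {0..l i} (h' i)"
    and bd: "\<And>i s. i < n \<Longrightarrow> s \<in> {0..l i} \<Longrightarrow> h i s \<in> {a..b}" and "a \<le> b"
    and F: "\<And>i. i < n \<Longrightarrow> finite (F i)"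
    and mult: "\<And>c S. finite S \<Longrightarrow>
      S \<subseteq> {(i, s). i < n \<and> s \<in> {0<..<l i} \<and> s \<notin> F i \<and> h' i s \<noteq> 0 \<and> h i s = c} \<Longrightarrow> card S \<le> N"
  shows "(\<Sum>i<n. integral {0..l i} (\<lambda>s. \<bar>h' i s\<bar>)) \<le> N * (b - a)"
proof (rule field_le_epsilon)
  fix \<epsilon> :: real assume eps: "0 < \<epsilon>"
  define \<epsilon>' where "\<epsilon>' = \<epsilon> / (real n + 1)"
  have eps': "0 < \<epsilon>'" "n * \<epsilon>' \<le> \<epsilon>" using eps by (auto simp: \<epsilon>'_def field_simps)
  define R where "R i m G \<longleftrightarrow> 0 < m \<and> G \<subseteq> {..<m} \<and>
    (\<forall>j\<in>G. \<forall>s\<in>{real j * l i / real m<..<real (Suc j) * l i / real m}. s \<notin> F i \<and> h' i s \<noteq> 0) \<and>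
    integral {0..l i} (\<lambda>s. \<bar>h' i s\<bar>) \<le>
       (\<Sum>j\<in>G. \<bar>h i (real (Suc j) * l i / real m) - h i (real j * l i / real m)\<bar>) + \<epsilon>'" for i m G
  have "\<exists>m G. R i m G" if i: "i < n" for i
  proof (rule variation_by_pieces[OF l[OF i] der[OF i] cont[OF i] F[OF i] eps'(1)])
    fix m G
    assume "0 < m" "G \<subseteq> {..<m}"
      "\<And>j s. j \<in> G \<Longrightarrow> s \<in> {real j * l i / real m<..<real (Suc j) * l i / real m} \<Longrightarrow> s \<notin> F i \<and> h' i s \<noteq> 0"
      "integral {0..l i} (\<lambda>s. \<bar>h' i s\<bar>) \<le>
         (\<Sum>j\<in>G. \<bar>h i (real (Suc j) * l i / real m) - h i (real j * l i / real m)\<bar>) + \<epsilon>'"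
    then have "R i m G" unfolding R_def by blast
    then show "\<exists>m G. R i m G" by blast
  qed
  then obtain m G where "\<And>i. i < n \<Longrightarrow> R i (m i) (G i)" by metis
  then have m: "\<And>i. i < n \<Longrightarrow> 0 < m i" and G: "\<And>i. i < n \<Longrightarrow> G i \<subseteq> {..<m i}"
    and good: "\<And>i j s. i < n \<Longrightarrow> j \<in> G i \<Longrightarrow>
      s \<in> {real j * l i / real (m i)<..<real (Suc j) * l i / real (m i)} \<Longrightarrow> s \<notin> F i \<and> h' i s \<noteq> 0"
    and le: "\<And>i. i < n \<Longrightarrow> integral {0..l i} (\<lambda>s. \<bar>h' i s\<bar>) \<le>
       (\<Sum>j\<in>G i. \<bar>h i (real (Suc j) * l i / real (m i)) - h i (real j * l i / real (m i))\<bar>) + \<epsilon>'"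
    unfolding R_def by blast+
  define t where "t i j = real j * l i / real (m i)" for i j
  have t: "0 \<le> t i j" "t i j < t i (Suc j)" "t i (Suc j) \<le> l i" if "i < n" "j \<in> G i" for i j
  proof -
    have "Suc j \<le> m i" using G[OF that(1)] that(2) by auto
    then have "real (Suc j) \<le> real (m i)" by (simp only: of_nat_le_iff)
    then have "real (Suc j) * l i \<le> real (m i) * l i" using l[OF that(1)] by (intro mult_right_mono) auto
    then show "0 \<le> t i j" "t i j < t i (Suc j)" "t i (Suc j) \<le> l i"
      using m[OF that(1)] l[OF that(1)] by (auto simp: t_def field_simps)
  qed
  define K where "K = (SIGMA i:{..<n}. G i)"
  have finG: "finite (G i)" if "i < n" for i using G[OF that] finite_subset by blast
  then have K: "finite K" unfolding K_def by (intro finite_SigmaI) auto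
  define p where "p k = (case k of (i, j) \<Rightarrow> min (h i (t i j)) (h i (t i (Suc j))))" for k
  define q where "q k = (case k of (i, j) \<Rightarrow> max (h i (t i j)) (h i (t i (Suc j))))" for k
  have "(\<Sum>i<n. integral {0..l i} (\<lambda>s. \<bar>h' i s\<bar>)) \<le> (\<Sum>i<n. (\<Sum>j\<in>G i. \<bar>h i (t i (Suc j)) - h i (t i j)\<bar>) + \<epsilon>')"
    using le by (intro sum_mono) (auto simp: t_def)
  also have "\<dots> = (\<Sum>i<n. \<Sum>j\<in>G i. q (i, j) - p (i, j)) + n * \<epsilon>'"
  proof -
    have "\<bar>h i (t i (Suc j)) - h i (t i j)\<bar> = q (i, j) - p (i, j)" for i j
      by (auto simp: p_def q_def)
    then show ?thesis by (simp add: sum.distrib)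
  qed
  also have "(\<Sum>i<n. \<Sum>j\<in>G i. q (i, j) - p (i, j)) = (\<Sum>k\<in>K. q k - p k)"
    unfolding K_def using finG by (subst sum.Sigma) auto
  also have "\<dots> \<le> N * (b - a)"
  proof (rule sum_lengths_le[OF K _ \<open>a \<le> b\<close>])
    fix k assume "k \<in> K"
    then obtain i j where k: "k = (i, j)" "i < n" "j \<in> G i" by (auto simp: K_def)
    have "h i (t i j) \<in> {a..b}" "h i (t i (Suc j)) \<in> {a..b}"
      by (intro bd[OF k(2)]; use t[OF k(2,3)] in auto)+
    then show "p k \<le> q k \<and> {p k<..<q k} \<subseteq> {a..b}" by (auto simp: k(1) p_def q_def)
  next
    fix c
    let ?K = "{k \<in> K. c \<in> {p k<..<q k}}"
    have "\<exists>s. s \<in> {t i j<..<t i (Suc j)} \<and> h i s = c" if "i < n" "j \<in> G i" "c \<in> {p (i, j)<..<q (i, j)}" for i j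
    proof -
      note tt = t[OF that(1,2)]
      have "continuous_on {0..l i} (h i)"
        by (rule DERIV_continuous_on) (rule der[OF that(1)])
      then have cont_h: "continuous_on {t i j..t i (Suc j)} (h i)"
        using tt by (auto elim: continuous_on_subset)
      have "\<exists>s\<ge>t i j. s \<le> t i (Suc j) \<and> h i s = c"
      proof (cases "h i (t i j) \<le> c")
        case True
        then show ?thesis using that(3) tt by (intro IVT'[OF _ _ _ cont_h]) (auto simp: p_def q_def)
      next
        case False
        then show ?thesis using that(3) tt by (intro IVT2'[OF _ _ _ cont_h]) (auto simp: p_def q_def)
      qed
      then obtain s where s: "t i j \<le> s" "s \<le> t i (Suc j)" "h i s = c" by blast
      moreover have "s \<noteq> t i j" "s \<noteq> t i (Suc j)" using that(3) s by (auto simp: p_def q_def)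
      ultimately show ?thesis by (intro exI[of _ s]) auto
    qed
    then have "\<forall>k\<in>?K. \<exists>s. s \<in> {t (fst k) (snd k)<..<t (fst k) (Suc (snd k))} \<and> h (fst k) s = c"
      by (auto simp: K_def)
    then obtain s where s: "\<And>k. k \<in> ?K \<Longrightarrow> s k \<in> {t (fst k) (snd k)<..<t (fst k) (Suc (snd k))} \<and> h (fst k) (s k) = c"
      by metis
    \<comment> \<open>The pieces of one curve are disjoint: the parameter determines its piece.\<close>
    have inj: "inj_on (\<lambda>k. (fst k, s k)) ?K"
    proof (rule inj_onI)
      fix k k' assume kk: "k \<in> ?K" "k' \<in> ?K" "(fst k, s k) = (fst k', s k')"
      then have "fst k < n" by (auto simp: K_def)
      then have "nat \<lfloor>s k * real (m (fst k)) / l (fst k)\<rfloor> = snd k" "nat \<lfloor>s k * real (m (fst k)) / l (fst k)\<rfloor> = snd k'"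
        using s[OF kk(1)] s[OF kk(2)] kk(3) l m by (auto simp: t_def intro!: piece_index_eq_floor)
      then show "k = k'" using kk(3) by (simp add: prod_eq_iff)
    qed
    have "card ((\<lambda>k. (fst k, s k)) ` ?K) \<le> N"
    proof (rule mult[of _ c])
      show "(\<lambda>k. (fst k, s k)) ` ?K \<subseteq> {(i, s). i < n \<and> s \<in> {0<..<l i} \<and> s \<notin> F i \<and> h' i s \<noteq> 0 \<and> h i s = c}"
      proof
        fix x assume "x \<in> (\<lambda>k. (fst k, s k)) ` ?K"
        then obtain i j where k: "(i, j) \<in> ?K" "x = (i, s (i, j))" by auto
        then have ij: "i < n" "j \<in> G i" by (auto simp: K_def)
        have "s (i, j) \<in> {t i j<..<t i (Suc j)}" "h i (s (i, j)) = c" using s[OF k(1)] by auto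
        then show "x \<in> {(i, s). i < n \<and> s \<in> {0<..<l i} \<and> s \<notin> F i \<and> h' i s \<noteq> 0 \<and> h i s = c}"
          using good[OF ij, of "s (i, j)"] t[OF ij] ij k(2) by (auto simp: t_def)
      qed
    qed (use K in simp)
    then show "card ?K \<le> N" by (simp only: card_image[OF inj])
  qed
  finally show "(\<Sum>i<n. integral {0..l i} (\<lambda>s. \<bar>h' i s\<bar>)) \<le> N * (b - a) + \<epsilon>" using eps' by simp
qed

section \<open>Curves in the nodal set\<close>

lemma second_derivative_eq:
  assumes "0 < l" "s \<in> {0..l}"
    and g1: "\<And>s. s \<in> {0..l} \<Longrightarrow> (\<gamma> has_vector_derivative \<gamma>1 s) (at s within {0..l})"
    and g2: "\<And>s. s \<in> {0..l} \<Longrightarrow> (\<gamma>1 has_vector_derivative \<gamma>2 s) (at s within {0..l})"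
  shows "second_derivative l \<gamma> s = \<gamma>2 s"
proof -
  have vd: "vector_derivative f (at t within {0..l}) = f'"
    if "(f has_vector_derivative f') (at t within {0..l})" "t \<in> {0..l}" for f :: "real \<Rightarrow> real ^ 2" and f' t
    using vector_derivative_within_cbox[of 0 l t f f'] that assms(1) by simp
  have "((\<lambda>t. vector_derivative \<gamma> (at t within {0..l})) has_vector_derivative \<gamma>2 s) (at s within {0..l})"
    by (rule has_vector_derivative_transform[OF assms(2) _ g2[OF assms(2)]]) (use vd g1 in auto)
  then show ?thesis unfolding second_derivative_def using vd assms(2) by blast
qed

lemma plane_orthogonal_decomposition:
  fixes u w n :: "real ^ 2"
  assumes "norm u = 1" "u \<bullet> w = 0" "w \<noteq> 0"
  obtains \<alpha> \<beta> where "n = \<alpha> *\<^sub>R u + \<beta> *\<^sub>R w"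
proof -
  define k where "k = u $ 1 * w $ 2 - u $ 2 * w $ 1"
  have u: "u $ 1 * u $ 1 + u $ 2 * u $ 2 = 1"
    using assms(1) by (simp add: norm_eq_1 inner_vec_def sum_2)
  have uw: "u $ 1 * w $ 1 + u $ 2 * w $ 2 = 0"
    using assms(2) by (simp add: inner_vec_def sum_2)
  have w: "w $ 1 = - k * u $ 2" "w $ 2 = k * u $ 1"
    using u uw unfolding k_def by algebra+
  then have k: "k \<noteq> 0" using assms(3) by (auto simp: vec_eq_iff forall_2)
  have "n $ 1 = (n $ 1 * u $ 1 + n $ 2 * u $ 2) * u $ 1 - (n $ 2 * u $ 1 - n $ 1 * u $ 2) * u $ 2"
    "n $ 2 = (n $ 1 * u $ 1 + n $ 2 * u $ 2) * u $ 2 + (n $ 2 * u $ 1 - n $ 1 * u $ 2) * u $ 1"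
    using u by algebra+
  then have "n = (n $ 1 * u $ 1 + n $ 2 * u $ 2) *\<^sub>R u + ((n $ 2 * u $ 1 - n $ 1 * u $ 2) / k) *\<^sub>R w"
    using k by (simp add: vec_eq_iff forall_2 w)
  then show thesis by (rule that)
qed

lemma locally_zero_derivative:
  assumes "(f has_derivative f') (at s)" "open S" "s \<in> S" "\<And>u. u \<in> S \<Longrightarrow> f u = c"
  shows "f' = (\<lambda>_. 0)"
proof -
  have "(f has_derivative (\<lambda>_. 0)) (at s)"
    by (rule has_derivative_transform_within_open[OF has_derivative_const assms(2,3)]) (simp add: assms(4))
  then show ?thesis using assms(1) has_derivative_unique by blast
qed

text \<open>
  Differentiating \<open>\<phi> (\<gamma> u) = 0\<close> once gives \<open>\<partial>\<^sub>v \<phi> = 0\<close> for the tangent \<open>v = \<gamma>' u\<close>, and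
  differentiating this again gives \<open>\<partial>\<^sub>v \<partial>\<^sub>v \<phi> = - \<partial>\<^sub>w \<phi>\<close> for \<open>w = \<gamma>'' u\<close>. Since \<open>w\<close> is orthogonal
  to \<open>v\<close> and \<open>\<partial>\<^sub>v \<phi> = 0\<close>, the right-hand side can only vanish at a singular point or where \<open>w = 0\<close>.
  So the derivative of \<open>\<partial>\<^sub>v \<phi>\<close> along the nodal line is nonzero.
\<close>

lemma nodal_curve_nondegenerate:
  fixes \<gamma> \<gamma>1 :: "real \<Rightarrow> real ^ 2" and \<gamma>2 :: "real ^ 2"
  assumes S: "open S" "s \<in> S"
    and g1: "\<And>u. u \<in> S \<Longrightarrow> (\<gamma> has_vector_derivative \<gamma>1 u) (at u)"
    and g2: "(\<gamma>1 has_vector_derivative \<gamma>2) (at s)"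
    and unit: "\<And>u. u \<in> S \<Longrightarrow> norm (\<gamma>1 u) = 1"
    and zero: "\<And>u. u \<in> S \<Longrightarrow> trig F a (\<gamma> u) = 0"
    and curved: "\<gamma>2 \<noteq> 0" and reg: "trig F (dir_deriv n a) (\<gamma> s) \<noteq> 0"
  shows "trig F (dir_deriv (\<gamma>1 s) a) (\<gamma> s) = 0"
    and "trig F (dir_deriv (\<gamma>1 s) (dir_deriv (\<gamma>1 s) a)) (\<gamma> s) \<noteq> 0"
proof -
  have tangent: "trig F (dir_deriv (\<gamma>1 u) a) (\<gamma> u) = 0" if "u \<in> S" for u
  proof -
    have "((\<lambda>u. trig F a (\<gamma> u)) has_derivative (\<lambda>t. trig F (dir_deriv (t *\<^sub>R \<gamma>1 u) a) (\<gamma> u))) (at u)"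
      using has_derivative_compose[OF g1[OF that, unfolded has_vector_derivative_def] trig_has_derivative] .
    from locally_zero_derivative[OF this S(1) that zero] show ?thesis by (metis scaleR_one)
  qed
  then show t0: "trig F (dir_deriv (\<gamma>1 s) a) (\<gamma> s) = 0" using S by blast
  note d1 = g1[OF S(2), unfolded has_vector_derivative_def] and d2 = g2[unfolded has_vector_derivative_def]
  have "((\<lambda>u. \<gamma>1 u \<bullet> \<gamma>1 u) has_derivative (\<lambda>t. \<gamma>1 s \<bullet> (t *\<^sub>R \<gamma>2) + (t *\<^sub>R \<gamma>2) \<bullet> \<gamma>1 s)) (at s)"
    by (rule has_derivative_inner[OF d2 d2])
  then have "(\<lambda>t. \<gamma>1 s \<bullet> (t *\<^sub>R \<gamma>2) + (t *\<^sub>R \<gamma>2) \<bullet> \<gamma>1 s) = (\<lambda>_. 0)"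
    by (rule locally_zero_derivative[OF _ S]) (use unit in \<open>simp add: norm_eq_1\<close>)
  from fun_cong[OF this, of 1] have orth: "\<gamma>1 s \<bullet> \<gamma>2 = 0" by (simp add: inner_commute)
  have "((\<lambda>u. trig F (dir_deriv (\<gamma>1 u) a) (\<gamma> u)) has_derivative
      (\<lambda>t. \<Sum>\<xi>\<in>F. a \<xi> * (2 * pi * \<i> * (\<gamma>1 s \<bullet> real_vec \<xi>)) *
          (2 * pi * \<i> * ((t *\<^sub>R \<gamma>1 s) \<bullet> real_vec \<xi>) * e (\<gamma> s \<bullet> real_vec \<xi>)) +
        a \<xi> * (2 * pi * \<i> * ((t *\<^sub>R \<gamma>2) \<bullet> real_vec \<xi>)) * e (\<gamma> s \<bullet> real_vec \<xi>))) (at s)"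
    unfolding trig_def dir_deriv_def
    by (intro has_derivative_sum has_derivative_mult has_derivative_mult_right has_derivative_of_real
        e_compose_has_derivative has_derivative_inner_left d1 d2)
  from fun_cong[OF locally_zero_derivative[OF this S tangent], of 1]
  have second: "trig F (dir_deriv (\<gamma>1 s) (dir_deriv (\<gamma>1 s) a)) (\<gamma> s) + trig F (dir_deriv \<gamma>2 a) (\<gamma> s) = 0"
    by (simp add: trig_def dir_deriv_def sum_subtractf sum_negf mult_ac)
  obtain \<alpha> \<beta> where "n = \<alpha> *\<^sub>R \<gamma>1 s + \<beta> *\<^sub>R \<gamma>2"
    using plane_orthogonal_decomposition[OF unit[OF S(2)] orth curved] by blast
  then have "trig F (dir_deriv \<gamma>2 a) (\<gamma> s) \<noteq> 0"
    using reg t0 by (auto simp: dir_deriv_linear)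
  then show "trig F (dir_deriv (\<gamma>1 s) (dir_deriv (\<gamma>1 s) a)) (\<gamma> s) \<noteq> 0"
    using second by auto
qed

lemma regular_point_derivative:
  assumes \<phi>: "\<And>x. complex_of_real (\<phi> x) = trig F a x"
    and "x \<in> nodal_set \<phi>" "x \<notin> singular_set \<phi>"
  shows "\<exists>n. trig F (dir_deriv n a) x \<noteq> 0"
proof (rule ccontr)
  assume "\<nexists>n. trig F (dir_deriv n a) x \<noteq> 0"
  then have "(trig F a has_derivative (\<lambda>_. 0)) (at x)" using trig_has_derivative[of F a x UNIV] by simp
  then have "((\<lambda>x. Re (trig F a x)) has_derivative (\<lambda>_. Re 0)) (at x)"
    by (rule bounded_linear.has_derivative[OF bounded_linear_Re])
  moreover have "(\<lambda>x. Re (trig F a x)) = \<phi>" using \<phi> by (simp flip: \<phi>)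
  ultimately show False using assms(2,3) by (simp add: singular_set_def)
qed

lemma unit_vectors_with_component:
  fixes v :: "real ^ 2"
  assumes "norm v = 1" "v $ k = c"
  shows "v = (\<chi> j. if j = k then c else sqrt (1 - c\<^sup>2)) \<or> v = (\<chi> j. if j = k then c else - sqrt (1 - c\<^sup>2))"
proof -
  have "v $ 1 * v $ 1 + v $ 2 * v $ 2 = 1"
    using assms(1) by (simp add: norm_eq_1 inner_vec_def sum_2)
  then have "(v $ j)\<^sup>2 = 1 - c\<^sup>2" if "j \<noteq> k" for j
    using that assms(2) exhaust_2[of j] exhaust_2[of k] by (auto simp: power2_eq_square)
  then have "\<bar>v $ j\<bar> = sqrt (1 - c\<^sup>2)" if "j \<noteq> k" for j
    using that by (metis real_sqrt_abs)
  then have other: "v $ j = sqrt (1 - c\<^sup>2) \<or> v $ j = - sqrt (1 - c\<^sup>2)" if "j \<noteq> k" for j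
    using that by (metis abs_if minus_minus)
  from other[of 1] other[of 2] show ?thesis
    using assms(2) exhaust_2[of k] by (auto simp: vec_eq_iff forall_2)
qed

lemma torus_eq_refl: "torus_eq x x"
  by (simp add: torus_eq_def)

text \<open>
  Parameters with the same unit tangent \<open>v\<close> and nonzero curvature are nondegenerate common zeros of
  \<open>\<phi>\<close> and \<open>\<partial>\<^sub>v \<phi>\<close>, and distinct parameters give distinct points of the torus because the curves
  meet regular points at most once. The endpoints of the curves are left out of the count,
  so all derivatives are two-sided.
\<close>

lemma total_curvature_le:
  assumes F: "\<And>\<xi> i. \<xi> \<in> F \<Longrightarrow> \<bar>\<xi> $ i\<bar> \<le> int M"
    and \<phi>: "\<And>x. complex_of_real (\<phi> x) = trig F a x"
    and nc: "nodal_curves \<phi> n l \<gamma>"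
  shows "(\<Sum>i<n. curve_total_curvature (l i) (\<gamma> i)) \<le> 64 * (real M)\<^sup>2"
proof -
  have arc: "arclength_C2 (l i) (\<gamma> i)" and nodal: "\<gamma> i ` {0..l i} \<subseteq> nodal_set \<phi>"
    and fin: "finite {s \<in> {0..l i}. \<gamma> i s \<in> singular_set \<phi>}" if "i < n" for i
    using nc that unfolding nodal_curves_def by blast+
  have sep: "i = j \<and> s = t"
    if "i < n" "j < n" "s \<in> {0..<l i}" "t \<in> {0..<l j}" "torus_eq (\<gamma> i s) (\<gamma> j t)" "\<gamma> i s \<notin> singular_set \<phi>"
    for i j s t
    using nc that unfolding nodal_curves_def by blast
  define R where "R i g1 g2 \<longleftrightarrow> (\<forall>s\<in>{0..l i}. (\<gamma> i has_vector_derivative g1 s) (at s within {0..l i})) \<and>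
      (\<forall>s\<in>{0..l i}. (g1 has_vector_derivative g2 s) (at s within {0..l i})) \<and>
      continuous_on {0..l i} g2 \<and> (\<forall>s\<in>{0..l i}. norm (g1 s) = 1)" for i g1 g2
  have "\<exists>g1 g2. R i g1 g2" if "i < n" for i
    using arc[OF that] unfolding arclength_C2_def R_def by blast
  then obtain g1 g2 where "\<And>i. i < n \<Longrightarrow> R i (g1 i) (g2 i)" by metis
  then have d1: "\<And>i s. i < n \<Longrightarrow> s \<in> {0..l i} \<Longrightarrow> (\<gamma> i has_vector_derivative g1 i s) (at s within {0..l i})"
    and d2: "\<And>i s. i < n \<Longrightarrow> s \<in> {0..l i} \<Longrightarrow> (g1 i has_vector_derivative g2 i s) (at s within {0..l i})"
    and cont: "\<And>i. i < n \<Longrightarrow> continuous_on {0..l i} (g2 i)"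
    and unit: "\<And>i s. i < n \<Longrightarrow> s \<in> {0..l i} \<Longrightarrow> norm (g1 i s) = 1"
    unfolding R_def by blast+
  have l: "0 < l i" if "i < n" for i using arc[OF that] by (simp add: arclength_C2_def)
  let ?Sing = "\<lambda>i. {s \<in> {0..l i}. \<gamma> i s \<in> singular_set \<phi>}"
  have count_dir: "card T \<le> 8 * M\<^sup>2"
    if T: "finite T" "T \<subseteq> {(i, s). i < n \<and> s \<in> {0<..<l i} \<and> s \<notin> ?Sing i \<and> g2 i s \<noteq> 0 \<and> g1 i s = v}" for T v
  proof -
    let ?pt = "\<lambda>(i, s). \<gamma> i s"
    have TD: "i < n" "s \<in> {0<..<l i}" "\<gamma> i s \<notin> singular_set \<phi>" "g2 i s \<noteq> 0" "g1 i s = v" if "(i, s) \<in> T" for i s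
      using T(2) that by auto
    have sepT: "k = k'" if k: "k \<in> T" "k' \<in> T" "torus_eq (?pt k) (?pt k')" for k k'
    proof -
      obtain i s j t where kk: "k = (i, s)" "k' = (j, t)" by fastforce
      have "i = j \<and> s = t"
        by (rule sep) (use TD[of i s] TD[of j t] k kk in auto)
      then show ?thesis using kk by simp
    qed
    have "card T = card (?pt ` T)"
      using sepT torus_eq_refl by (intro card_image[symmetric] inj_onI) metis
    also have "\<dots> \<le> 8 * M\<^sup>2"
    proof (rule nondegenerate_trig_zeros[OF F, where a = a and b = "dir_deriv v a"])
      show "finite (?pt ` T)" using T by simp
      show "x = y" if "x \<in> ?pt ` T" "y \<in> ?pt ` T" "torus_eq x y" for x y
        using that sepT by blast
    next
      fix x assume "x \<in> ?pt ` T"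
      then obtain i s where pt: "(i, s) \<in> T" "x = \<gamma> i s" by auto
      note t = TD[OF pt(1)]
      have der: "(\<gamma> i has_vector_derivative g1 i u) (at u)" "(g1 i has_vector_derivative g2 i u) (at u)"
        if "u \<in> {0<..<l i}" for u
        using d1[OF t(1), of u] d2[OF t(1), of u] that by (auto simp: at_within_Icc_at)
      have zero: "trig F a (\<gamma> i u) = 0" if "u \<in> {0<..<l i}" for u
      proof -
        have "u \<in> {0..l i}" using that by simp
        then have "\<phi> (\<gamma> i u) = 0" using nodal[OF t(1)] unfolding nodal_set_def by blast
        then show ?thesis using \<phi>[of "\<gamma> i u"] by simp
      qed
      have "\<gamma> i s \<in> nodal_set \<phi>" using \<phi>[of "\<gamma> i s"] zero[OF t(2)] by (simp add: nodal_set_def)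
      then obtain n' where n': "trig F (dir_deriv n' a) (\<gamma> i s) \<noteq> 0"
        using regular_point_derivative[OF \<phi>] t(3) by blast
      have nd: "trig F (dir_deriv (g1 i s) a) (\<gamma> i s) = 0"
        "trig F (dir_deriv (g1 i s) (dir_deriv (g1 i s) a)) (\<gamma> i s) \<noteq> 0"
        using nodal_curve_nondegenerate[OF _ t(2) der(1) der(2)[OF t(2)] _ zero t(4) n'] unit[OF t(1)]
        by simp_all
      show "trig F a x = 0 \<and> trig F (dir_deriv v a) x = 0" using nd zero t pt by auto
      show "\<exists>v' n. trig F (dir_deriv v' a) x = 0 \<and> trig F (dir_deriv n a) x \<noteq> 0 \<and>
          trig F (dir_deriv v' (dir_deriv v a)) x \<noteq> 0"
        using nd n' t pt by auto
    qed
    finally show ?thesis .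
  qed
  have count_component: "card T \<le> 16 * M\<^sup>2"
    if T: "finite T" "T \<subseteq> {(i, s). i < n \<and> s \<in> {0<..<l i} \<and> s \<notin> ?Sing i \<and> g2 i s $ k \<noteq> 0 \<and> g1 i s $ k = c}"
    for T k c
  proof -
    define T' where "T' v = {(i, s) \<in> T. g1 i s = v}" for v
    define vp vm :: "real ^ 2" where "vp = (\<chi> j. if j = k then c else sqrt (1 - c\<^sup>2))"
      and "vm = (\<chi> j. if j = k then c else - sqrt (1 - c\<^sup>2))"
    have T'_sub: "T' v \<subseteq> T" for v by (auto simp: T'_def)
    have T': "card (T' v) \<le> 8 * M\<^sup>2" for v
    proof (rule count_dir[of _ v])
      show "finite (T' v)" using T'_sub T(1) finite_subset by blast
      show "T' v \<subseteq> {(i, s). i < n \<and> s \<in> {0<..<l i} \<and> s \<notin> ?Sing i \<and> g2 i s \<noteq> 0 \<and> g1 i s = v}"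
        using T(2) by (auto simp: T'_def)
    qed
    have "T \<subseteq> T' vp \<union> T' vm"
    proof
      fix x assume x: "x \<in> T"
      obtain i s where pt: "x = (i, s)" by fastforce
      have "norm (g1 i s) = 1" "g1 i s $ k = c" using T(2) x pt unit[of i s] by auto
      then have "g1 i s = vp \<or> g1 i s = vm"
        using unit_vectors_with_component unfolding vp_def vm_def by blast
      then show "x \<in> T' vp \<union> T' vm" using x pt by (auto simp: T'_def)
    qed
    then have "card T \<le> card (T' vp \<union> T' vm)"
      using T'_sub T(1) by (intro card_mono) (auto intro: finite_subset)
    also have "\<dots> \<le> card (T' vp) + card (T' vm)" by (rule card_Un_le)
    also have "\<dots> \<le> 16 * M\<^sup>2" using T'[of vp] T'[of vm] by simp
    finally show ?thesis .
  qed
  have comp: "(\<Sum>i<n. integral {0..l i} (\<lambda>s. \<bar>g2 i s $ k\<bar>)) \<le> real (16 * M\<^sup>2) * (1 - (- 1))" for k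
  proof (rule total_variation_le_multiplicity[where h = "\<lambda>i s. g1 i s $ k" and F = "?Sing"])
    show "((\<lambda>s. g1 i s $ k) has_real_derivative g2 i s $ k) (at s within {0..l i})"
      if "i < n" "s \<in> {0..l i}" for i s
      using bounded_linear.has_vector_derivative[OF bounded_linear_vec_nth d2[OF that]]
      by (simp add: has_real_derivative_iff_has_vector_derivative)
    show "continuous_on {0..l i} (\<lambda>s. g2 i s $ k)" if "i < n" for i
      using cont[OF that] by (intro continuous_intros)
    show "g1 i s $ k \<in> {- 1..1}" if "i < n" "s \<in> {0..l i}" for i s
      using component_le_norm_cart[of "g1 i s" k] unit[OF that] by auto
    show "card T \<le> 16 * M\<^sup>2" if "finite T"
      "T \<subseteq> {(i, s). i < n \<and> s \<in> {0<..<l i} \<and> s \<notin> ?Sing i \<and> g2 i s $ k \<noteq> 0 \<and> g1 i s $ k = c}" for T c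
      by (rule count_component[OF that])
  qed (use l fin in auto)
  have "(\<Sum>i<n. curve_total_curvature (l i) (\<gamma> i)) \<le>
      (\<Sum>i<n. integral {0..l i} (\<lambda>s. \<bar>g2 i s $ 1\<bar>) + integral {0..l i} (\<lambda>s. \<bar>g2 i s $ 2\<bar>))"
  proof (rule sum_mono)
    fix i assume "i \<in> {..<n}"
    then have i: "i < n" by simp
    have int: "(\<lambda>s. \<bar>g2 i s $ k\<bar>) integrable_on {0..l i}" for k
      using cont[OF i] by (intro integrable_continuous_real continuous_intros)
    have "curve_total_curvature (l i) (\<gamma> i) = integral {0..l i} (\<lambda>s. norm (g2 i s))"
      unfolding curve_total_curvature_def
    proof (rule integral_cong)
      fix s assume "s \<in> {0..l i}"
      from second_derivative_eq[OF l[OF i] this d1[OF i] d2[OF i]]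
      show "norm (second_derivative (l i) (\<gamma> i) s) = norm (g2 i s)" by simp
    qed
    also have "\<dots> \<le> integral {0..l i} (\<lambda>s. \<bar>g2 i s $ 1\<bar> + \<bar>g2 i s $ 2\<bar>)"
    proof (rule integral_le)
      show "(\<lambda>s. norm (g2 i s)) integrable_on {0..l i}"
        using cont[OF i] by (intro integrable_continuous_real continuous_intros)
      show "norm (g2 i s) \<le> \<bar>g2 i s $ 1\<bar> + \<bar>g2 i s $ 2\<bar>" for s
        using norm_le_l1_cart[of "g2 i s"] by (simp add: sum_2)
    qed (intro integrable_add int)
    also have "\<dots> = integral {0..l i} (\<lambda>s. \<bar>g2 i s $ 1\<bar>) + integral {0..l i} (\<lambda>s. \<bar>g2 i s $ 2\<bar>)"
      by (intro integral_add int)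
    finally show "curve_total_curvature (l i) (\<gamma> i) \<le>
        integral {0..l i} (\<lambda>s. \<bar>g2 i s $ 1\<bar>) + integral {0..l i} (\<lambda>s. \<bar>g2 i s $ 2\<bar>)" .
  qed
  also have "\<dots> \<le> 64 * (real M)\<^sup>2" using comp[of 1] comp[of 2] by (simp add: sum.distrib)
  finally show ?thesis .
qed

theorem mainTheorem6:
  "\<exists>A::real. A > 0 \<and>
     (\<forall>(E::nat) (\<phi> :: real ^ 2 \<Rightarrow> real). E \<ge> 1 \<longrightarrow> eigenfunction E \<phi> \<longrightarrow>
        nodal_total_curvature \<phi> \<le> ennreal (A * real E))"
proof (intro exI[of _ 64] conjI allI impI)
  fix E :: nat and \<phi> :: "real ^ 2 \<Rightarrow> real"
  assume "eigenfunction E \<phi>"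
  then obtain a where \<phi>: "\<And>x. complex_of_real (\<phi> x) = trig (freqs E) a x"
    unfolding eigenfunction_def trig_def by blast
  define M where "M = nat \<lfloor>sqrt E\<rfloor>"
  have M: "real M \<le> sqrt E" "sqrt E < real M + 1" by (auto simp: M_def)
  then have "(real M)\<^sup>2 \<le> E" using power_mono[OF M(1), of 2] by simp
  have "real E < (real M + 1)\<^sup>2" using power_strict_mono[OF M(2), of 2] by simp
  then have F: "\<bar>\<xi> $ i\<bar> \<le> int M" if "\<xi> \<in> freqs E" for \<xi> i using freqs_bound that by blast
  show "nodal_total_curvature \<phi> \<le> ennreal (64 * real E)"
    unfolding nodal_total_curvature_def
  proof (rule SUP_least, clarify, rule ennreal_leI)
    fix n l \<gamma> assume "nodal_curves \<phi> n l \<gamma>"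
    from total_curvature_le[OF F \<phi> this] \<open>(real M)\<^sup>2 \<le> E\<close>
    show "(\<Sum>i<n. curve_total_curvature (l i) (\<gamma> i)) \<le> 64 * real E" by linarith
  qed
qed simp

end
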